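(* Let $p,q\in(1,\infty)$ and $A,\Gamma\in\mathbb{R}$ be given, such that $A^2+\Gamma\ge 0$ and $\Gamma\neq 0$. Assume that $\frac1p+\frac1q<1$. Then the system $$\begin{cases}-g''+2Ag'+\Gamma g=|f|^{p-2}f&\text{on }\mathbb{R}\\ -f''-2Af'+\Gamma f=|g|^{q-2}g&\text{on }\mathbb{R}\end{cases}$$ has a nontrivial solution $g,f$ such that $g\in W^{2,p'}(\mathbb{R})$ and $f\in W^{2,q'}(\mathbb{R})$.
   Context: Here $p'=\frac{p}{p-1}$ and $q'=\frac{q}{q-1}$; $W^{2,r}(\mathbb{R})$ is the usual Sobolev space. The expression $|t|^{r-2}t$ with $r>1$ is understood to be $0$ at $t=0$. Nontrivial means $(g,f)\not\equiv(0,0)$. *)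

theory Defs
  imports "HOL-Analysis.Analysis"
begin

definition test_function :: "(real \<Rightarrow> real) \<Rightarrow> bool" where
  "test_function \<phi> \<longleftrightarrow>
     (\<forall>n x. (deriv ^^ n) \<phi> differentiable (at x)) \<and> compact (closure {x. \<phi> x \<noteq> 0})"

definition locally_integrable :: "(real \<Rightarrow> real) \<Rightarrow> bool" where
  "locally_integrable u \<longleftrightarrow> (\<forall>K. compact K \<longrightarrow> set_integrable lebesgue K u)"

text \<open>The distributional derivative of order \<open>k\<close>. It is determined only up to
  null sets, hence a relation between functions.\<close>

definition weak_deriv :: "nat \<Rightarrow> (real \<Rightarrow> real) \<Rightarrow> (real \<Rightarrow> real) \<Rightarrow> bool" where
  "weak_deriv k u v \<longleftrightarrow> locally_integrable u \<and> locally_integrable v \<and>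
     (\<forall>\<phi>. test_function \<phi> \<longrightarrow>
        (LINT x|lebesgue. u x * (deriv ^^ k) \<phi> x) = (-1) ^ k * (LINT x|lebesgue. v x * \<phi> x))"

text \<open>\<open>L\<^sup>r\<close> and \<open>W\<^sup>k\<^sup>,\<^sup>r\<close> on the real line are represented by sets of functions, not of
  classes modulo equality almost everywhere.\<close>

definition Lp :: "real \<Rightarrow> (real \<Rightarrow> real) set" where
  "Lp r = {u. u \<in> borel_measurable lebesgue \<and> integrable lebesgue (\<lambda>x. \<bar>u x\<bar> powr r)}"

definition sobolev :: "nat \<Rightarrow> real \<Rightarrow> (real \<Rightarrow> real) set" where
  "sobolev k r = {u \<in> Lp r. \<forall>j\<le>k. \<exists>v\<in>Lp r. weak_deriv j u v}"

text \<open>The derivatives are weak ones and the equations hold almost everywhere.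
  Since \<open>0 powr a = 0\<close> and the factor \<open>t\<close> vanishes, \<open>\<bar>t\<bar> powr (r - 2) * t\<close> is \<open>0\<close> at \<open>t = 0\<close>
  for every \<open>r\<close>.\<close>

definition solves_system ::
    "real \<Rightarrow> real \<Rightarrow> real \<Rightarrow> real \<Rightarrow> (real \<Rightarrow> real) \<Rightarrow> (real \<Rightarrow> real) \<Rightarrow> bool" where
  "solves_system p q A \<Gamma> g f \<longleftrightarrow>
     (\<exists>g1 g2 f1 f2.
        weak_deriv 1 g g1 \<and> weak_deriv 2 g g2 \<and> weak_deriv 1 f f1 \<and> weak_deriv 2 f f2 \<and>
        (AE x in lebesgue. - g2 x + 2 * A * g1 x + \<Gamma> * g x = \<bar>f x\<bar> powr (p - 2) * f x) \<and>
        (AE x in lebesgue. - f2 x - 2 * A * f1 x + \<Gamma> * f x = \<bar>g x\<bar> powr (q - 2) * g x))"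

end

theory Submission
  imports Defs "HOL-Complex_Analysis.Great_Picard"
begin

text \<open>
  Throughout, \<open>*\<close> between functions denotes convolution in the explanatory text.

  Write \<open>a\<close> and \<open>b\<close> for the real numbers \<open>A \<plusminus> sqrt (A\<^sup>2 + \<Gamma>)\<close>. They are nonzero, with product \<open>-\<Gamma>\<close> and sum
  \<open>2 A\<close>, so that the operators of the system factor as \<open>-(D - a) (D - b)\<close> and \<open>-(D + a) (D + b)\<close> with \<open>D\<close> for
  the derivative. Each first-order factor is inverted, up to sign, by convolution with the exponential
  \<open>exp (a x)\<close> restricted to the half-line where it decays (\<open>weak_deriv_conv_exp_kernel\<close>,
  \<open>second_order_solution\<close>). Hence it suffices to find nonnegative \<open>f\<close> and \<open>g\<close>, not both zero, with
  \<open>g = H * f\<^bsup>p-1\<^esup>\<close> and \<open>f = H' * g\<^bsup>q-1\<^esup>\<close>, where \<open>H\<close> is the convolution of two such exponentials and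
  \<open>H'\<close> its reflection; then \<open>sgn \<Gamma> g\<close> and \<open>f\<close> solve the system. Summability of \<open>f\<^sup>p\<close> and \<open>g\<^sup>q\<close> together
  with \<open>L\<^sup>1 * L\<^sup>r \<subseteq> L\<^sup>r\<close> gives the Sobolev regularity.

  Let \<open>r\<close> be the exponent conjugate to \<open>p\<close>. The condition on the exponents means \<open>r < q\<close>. Maximize
  \<open>\<integral>(H * u)\<^sup>q\<close> over \<open>u \<ge> 0\<close> with \<open>\<integral>u\<^sup>r \<le> 1\<close>. The supremum \<open>S\<close> is finite and positive. A maximizing sequence
  \<open>u\<close> cannot vanish: if \<open>H * u \<le> c\<close> then \<open>\<integral>(H * u)\<^sup>q \<le> c\<^bsup>q-r\<^esup> \<integral>(H * u)\<^sup>r\<close>, and the last integral is bounded. So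
  after a translation \<open>H * u\<close> is bounded below at the origin (\<open>maximizing_element\<close>).

  No splitting of mass has to be excluded, because compactness of \<open>u\<close> itself is not needed. Put
  \<open>F = H' * (H * u)\<^bsup>q-1\<^esup>\<close>. By duality \<open>\<integral>u F = \<integral>(H * u)\<^sup>q\<close>, which tends to \<open>S\<close>, while \<open>\<integral>F\<^sup>p \<le> S\<^sup>p\<close>. Thus the total
  deficit in Young's inequality for \<open>u\<close> and \<open>F / S\<close> tends to \<open>0\<close>, and by stability of Young's inequality
  (\<open>young_deficit\<close>) \<open>H * u\<close> and \<open>H * (F / S)\<^bsup>p-1\<^esup>\<close> become uniformly close
  (\<open>almost_Euler_Lagrange\<close>). The functions \<open>H * u\<close> are bounded and equicontinuous, so a subsequence
  converges pointwise to some \<open>g\<close>; by dominated convergence \<open>F\<close> converges to \<open>f = H' * g\<^bsup>q-1\<^esup>\<close> and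
  \<open>g = H * (f / S)\<^bsup>p-1\<^esup>\<close>. The lower bound at the origin survives, and a scaling removes \<open>S\<close>.
\<close>

section \<open>Young's inequality and its stability\<close>

lemma young_powr:
  fixes a b r :: real
  assumes "1 < r" "0 \<le> a" "0 \<le> b"
  shows "a * b powr (r - 1) \<le> a powr r / r + (1 - 1 / r) * b powr r"
proof -
  have "a * b powr (r - 1)
      \<le> a powr r / r + (b powr (r - 1)) powr (r / (r - 1)) / (r / (r - 1))"
    using assms by (intro Youngs_inequality) (auto simp: field_simps)
  also have "\<dots> = a powr r / r + (1 - 1 / r) * b powr r"
    using assms by (simp add: powr_powr) (simp add: field_simps)
  finally show ?thesis .
qed

lemma young_powr_strict:
  fixes a b r :: real
  assumes r: "1 < r" and ab: "0 \<le> a" "0 \<le> b" "a \<noteq> b"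
  shows "a * b powr (r - 1) < a powr r / r + (1 - 1 / r) * b powr r"
proof (cases "a = 0 \<or> b = 0")
  case True
  then show ?thesis using r ab by auto
next
  case False
  then have pos: "0 < a" "0 < b" using ab by auto
  define t where "t = a / b"
  define h where "h = (\<lambda>s::real. s powr r / r - s)"
  have t: "0 < t" "t \<noteq> 1" using pos ab by (auto simp: t_def)
  have dh: "DERIV h s :> s powr (r - 1) - 1" if "0 < s" for s
    unfolding h_def using that r
    by (auto intro!: derivative_eq_intros simp: field_simps powr_diff)
  have "h 1 < h t"
  proof (cases "1 < t")
    case True
    obtain z where z: "1 < z" "z < t" "h t - h 1 = (t - 1) * (z powr (r - 1) - 1)"
      using MVT2[OF True, of h "\<lambda>s. s powr (r - 1) - 1"] dh by force
    have "1 < z powr (r - 1)" using z r by (simp add: gr_one_powr)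
    then have "0 < h t - h 1" unfolding z(3) using True by simp
    then show ?thesis by simp
  next
    case False
    then have lt: "t < 1" using t by simp
    obtain z where z: "t < z" "z < 1" "h 1 - h t = (1 - t) * (z powr (r - 1) - 1)"
      using MVT2[OF lt, of h "\<lambda>s. s powr (r - 1) - 1"] dh t by force
    have "z powr (r - 1) < 1 powr (r - 1)" using z t r by (intro powr_less_mono2) auto
    then have "h 1 - h t < 0" unfolding z(3) using lt by (simp add: mult_less_0_iff)
    then show ?thesis by simp
  qed
  then have "0 < t powr r / r + (1 - 1 / r) - t"
    using r by (simp add: h_def diff_divide_distrib)
  then have "0 < b powr r * (t powr r / r + (1 - 1 / r) - t)" using pos by simp
  also have "\<dots> = a powr r / r + (1 - 1 / r) * b powr r - a * b powr (r - 1)"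
    using pos by (simp add: t_def powr_divide powr_diff field_simps)
  finally show ?thesis by simp
qed

lemma powr_convex_combination:
  fixes r s u w :: real
  assumes r: "1 < r" and s: "0 < s" "s < 1" and uw: "0 \<le> u" "0 \<le> w"
  shows "((1 - s) * w + s * u) powr r \<le> (1 - s) * w powr r + s * u powr r"
proof -
  have *: "(c * x) powr r \<le> c * x powr r" if "0 < c" "c < 1" "0 \<le> x" for c x :: real
  proof -
    have "c powr r \<le> c powr 1" using that r by (intro powr_mono') auto
    then show ?thesis using that by (simp add: powr_mult mult_right_mono)
  qed
  show ?thesis
  proof (cases "u = 0 \<or> w = 0")
    case True
    then show ?thesis using *[of s u] *[of "1 - s" w] s uw by auto
  next
    case False
    then show ?thesis
      using convex_onD[OF powr_convex[of r], of s w u] r s uw by simp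
  qed
qed

text \<open>Young's inequality is stable: if its deficit at \<open>(u, w)\<close> is small, then \<open>u\<close> is close to \<open>w\<close>,
  uniformly for \<open>w\<close> in a bounded interval. The bound is linear in the deficit, so that it can
  be integrated. By convexity in \<open>u\<close> it suffices to bound the deficit from below where
  \<open>\<bar>u - w\<bar> = \<delta>\<close>, which is a compact set on which the deficit is positive.\<close>

lemma young_deficit:
  fixes r W \<delta> :: real
  assumes r: "1 < r" and \<delta>: "0 < \<delta>"
  obtains c where "0 \<le> c" "\<And>u w. 0 \<le> u \<Longrightarrow> 0 \<le> w \<Longrightarrow> w \<le> W \<Longrightarrow>
    \<bar>u - w\<bar> \<le> \<delta> + c * (u powr r / r + (1 - 1 / r) * w powr r - u * w powr (r - 1))"
proof -
  define d where "d = (\<lambda>u w::real. u powr r / r + (1 - 1 / r) * w powr r - u * w powr (r - 1))"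
  define S where "S = ({0..W + \<delta>} \<times> {0..W}) \<inter> {z. \<bar>fst z - snd z\<bar> = \<delta>}"
  have d0: "0 \<le> d u w" if "0 \<le> u" "0 \<le> w" for u w
    using young_powr[OF r that] by (simp add: d_def)
  show ?thesis
  proof (cases "0 \<le> W")
    case False
    then show ?thesis by (intro that[of 0]) auto
  next
    case True
    have "compact S" unfolding S_def
      by (intro compact_Int_closed compact_Times compact_Icc closed_Collect_eq continuous_intros)
    moreover have "(\<delta>, 0) \<in> S" using True \<delta> by (auto simp: S_def)
    moreover have "continuous_on S (\<lambda>z. d (fst z) (snd z))"
      unfolding d_def using r
      by (intro continuous_intros continuous_on_powr') (auto simp: S_def)
    ultimately obtain z where z: "z \<in> S" "\<And>y. y \<in> S \<Longrightarrow> d (fst z) (snd z) \<le> d (fst y) (snd y)"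
      using continuous_attains_inf[of S "\<lambda>z. d (fst z) (snd z)"] by (metis empty_iff)
    define m where "m = d (fst z) (snd z)"
    have "fst z \<noteq> snd z" "0 \<le> fst z" "0 \<le> snd z" using z(1) \<delta> by (auto simp: S_def)
    then have m: "0 < m" using young_powr_strict[OF r] by (simp add: m_def d_def)
    have main: "\<bar>u - w\<bar> \<le> \<delta> + (\<delta> / m) * d u w" if u: "0 \<le> u" and w: "0 \<le> w" "w \<le> W" for u w
    proof (cases "\<bar>u - w\<bar> \<le> \<delta>")
      case True
      then show ?thesis using d0[OF u w(1)] m \<delta> by (simp add: add_increasing2)
    next
      case False
      define s where "s = \<delta> / \<bar>u - w\<bar>"
      have s: "0 < s" "s < 1" using False \<delta> by (auto simp: s_def field_simps)
      define v where "v = (1 - s) * w + s * u"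
      have v0: "0 \<le> v" using s u w by (simp add: v_def)
      have vw: "v - w = s * (u - w)" by (simp add: v_def algebra_simps)
      have avw: "\<bar>v - w\<bar> = \<delta>"
        unfolding vw abs_mult using False \<delta> by (simp add: s_def)
      have vS: "(v, w) \<in> S" using v0 w avw by (auto simp: S_def)
      \<comment> \<open>\<open>v\<close> lies on the segment from \<open>w\<close> to \<open>u\<close>, at distance \<open>\<delta>\<close> from \<open>w\<close>\<close>
      have "v powr r \<le> (1 - s) * w powr r + s * u powr r"
        unfolding v_def using powr_convex_combination[OF r s u w(1)] .
      then have "v powr r / r \<le> ((1 - s) * w powr r + s * u powr r) / r"
        using r by (simp add: divide_right_mono)
      moreover have "w powr r = w * w powr (r - 1)"
        using w by (cases "w = 0") (auto simp: powr_diff)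
      ultimately have "d v w \<le> s * d u w"
        by (simp add: d_def v_def algebra_simps add_divide_distrib diff_divide_distrib)
      moreover have "m \<le> d v w" using z(2)[OF vS] by (simp add: m_def)
      ultimately have "m \<le> s * d u w" by simp
      then have "m * \<bar>u - w\<bar> \<le> \<delta> * d u w"
        using False \<delta> by (simp add: s_def field_simps)
      then have "\<bar>u - w\<bar> \<le> (\<delta> / m) * d u w" using m by (simp add: field_simps)
      then show ?thesis using \<delta> by simp
    qed
    show ?thesis
      using main m \<delta> by (intro that[of "\<delta> / m"]) (auto simp: d_def)
  qed
qed

section \<open>Convolution of nonnegative functions\<close>

text \<open>All densities and solutions are represented by bounded nonnegative Borel functions. Their
  convolutions are finite everywhere, and Tonelli's theorem applies without further hypotheses.\<close>

definition nonneg_bounded :: "(real \<Rightarrow> real) \<Rightarrow> bool" where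
  "nonneg_bounded u \<longleftrightarrow> u \<in> borel_measurable borel \<and> (\<forall>x. 0 \<le> u x) \<and> (\<exists>B. \<forall>x. u x \<le> B)"

text \<open>Convolution kernels are nonnegative, bounded and integrable.\<close>

definition conv_kernel :: "(real \<Rightarrow> real) \<Rightarrow> bool" where
  "conv_kernel K \<longleftrightarrow> nonneg_bounded K \<and> integrable lborel K"

text \<open>Convolution of a kernel with a density, evaluated at every point.\<close>

definition conv :: "(real \<Rightarrow> real) \<Rightarrow> (real \<Rightarrow> real) \<Rightarrow> real \<Rightarrow> real" where
  "conv K u x = (\<integral>y. K (x - y) * u y \<partial>lborel)"

text \<open>The total mass of a kernel.\<close>

definition mass :: "(real \<Rightarrow> real) \<Rightarrow> real" where
  "mass K = (\<integral>y. K y \<partial>lborel)"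

text \<open>The \<open>r\<close>-th power of the \<open>L\<^sup>r\<close> norm of a nonnegative function, with value \<open>\<infinity>\<close> if the function
  is not in \<open>L\<^sup>r\<close>.\<close>

definition power_integral :: "real \<Rightarrow> (real \<Rightarrow> real) \<Rightarrow> ennreal" where
  "power_integral r u = (\<integral>\<^sup>+x. ennreal (u x powr r) \<partial>lborel)"

lemma nonneg_bounded_meas [measurable_dest]: "nonneg_bounded u \<Longrightarrow> u \<in> borel_measurable borel"
  and nonneg_bounded_nonneg: "nonneg_bounded u \<Longrightarrow> 0 \<le> u x"
  and nonneg_bounded_bound: "nonneg_bounded u \<Longrightarrow> \<exists>B\<ge>0. \<forall>x. u x \<le> B"
  unfolding nonneg_bounded_def using order_trans by blast+

lemma nonneg_boundedI: "u \<in> borel_measurable borel \<Longrightarrow> (\<And>x. 0 \<le> u x) \<Longrightarrow> (\<And>x. u x \<le> B) \<Longrightarrow> nonneg_bounded u"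
  unfolding nonneg_bounded_def by blast

lemma conv_kernelD: "conv_kernel K \<Longrightarrow> nonneg_bounded K" "conv_kernel K \<Longrightarrow> integrable lborel K"
  "conv_kernel K \<Longrightarrow> K \<in> borel_measurable borel" "conv_kernel K \<Longrightarrow> 0 \<le> K x"
  by (auto simp: conv_kernel_def nonneg_bounded_def)

lemma nonneg_bounded_powr:
  assumes "nonneg_bounded u" "0 \<le> s" shows "nonneg_bounded (\<lambda>x. u x powr s)"
proof -
  obtain B where "\<And>x. u x \<le> B" "0 \<le> B" using nonneg_bounded_bound[OF assms(1)] by blast
  note [measurable] = nonneg_bounded_meas[OF assms(1)]
  show ?thesis
    using assms \<open>\<And>x. u x \<le> B\<close> nonneg_bounded_nonneg[OF assms(1)]
    by (intro nonneg_boundedI[of _ "B powr s"]) (auto intro: powr_mono2)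
qed

lemma nonneg_bounded_cmult:
  assumes "nonneg_bounded u" "0 \<le> s" shows "nonneg_bounded (\<lambda>x. s * u x)"
proof -
  obtain B where "\<And>x. u x \<le> B" "0 \<le> B" using nonneg_bounded_bound[OF assms(1)] by blast
  note [measurable] = nonneg_bounded_meas[OF assms(1)]
  show ?thesis
    using assms \<open>\<And>x. u x \<le> B\<close> nonneg_bounded_nonneg[OF assms(1)]
    by (intro nonneg_boundedI[of _ "s * B"]) (auto intro: mult_left_mono)
qed

lemma nonneg_bounded_affine:
  assumes "nonneg_bounded u" shows "nonneg_bounded (\<lambda>x. u (s + c * x))"
proof -
  note [measurable] = nonneg_bounded_meas[OF assms]
  show ?thesis using assms unfolding nonneg_bounded_def by auto
qed

lemma conv_kernel_shift:
  assumes "conv_kernel K"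
  shows "integrable lborel (\<lambda>y. K (x - y))" "(\<integral>y. K (x - y) \<partial>lborel) = mass K"
proof -
  show "integrable lborel (\<lambda>y. K (x - y))"
    using lborel_integrable_real_affine[OF conv_kernelD(2)[OF assms], of "-1" x] by simp
  show "(\<integral>y. K (x - y) \<partial>lborel) = mass K"
    using lborel_integral_real_affine[of "-1" K x] by (simp add: mass_def)
qed

lemma mass_nonneg: "conv_kernel K \<Longrightarrow> 0 \<le> mass K"
  by (simp add: mass_def conv_kernelD)

lemma conv_kernel_reflect:
  assumes "conv_kernel K" shows "conv_kernel (\<lambda>x. K (- x))" "mass (\<lambda>x. K (- x)) = mass K"
  using nonneg_bounded_affine[OF conv_kernelD(1)[OF assms], of 0 "-1"] conv_kernel_shift(1,2)[OF assms, of 0]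
  by (auto simp: conv_kernel_def mass_def)

lemma conv_integrable:
  assumes "conv_kernel K" "nonneg_bounded u" shows "integrable lborel (\<lambda>y. K (x - y) * u y)"
proof -
  obtain B where B: "\<And>x. u x \<le> B" "0 \<le> B" using nonneg_bounded_bound[OF assms(2)] by blast
  note [measurable] = nonneg_bounded_meas[OF assms(2)] conv_kernelD(3)[OF assms(1)]
  show ?thesis
    using B nonneg_bounded_nonneg[OF assms(2)] conv_kernelD(4)[OF assms(1)]
    by (intro Bochner_Integration.integrable_bound[OF integrable_mult_right[OF conv_kernel_shift(1)[OF assms(1)], of B x]])
      (auto simp: abs_mult mult.commute intro!: mult_right_mono AE_I2)
qed

lemma conv_eq_nn:
  assumes "conv_kernel K" "nonneg_bounded u"
  shows "ennreal (conv K u x) = (\<integral>\<^sup>+y. ennreal (K (x - y)) * ennreal (u y) \<partial>lborel)"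
  unfolding conv_def using conv_integrable[OF assms] nonneg_bounded_nonneg[OF assms(2)] conv_kernelD(4)[OF assms(1)]
  by (subst nn_integral_eq_integral[symmetric]) (auto simp: ennreal_mult)

lemma conv_nonneg:
  assumes "conv_kernel K" "nonneg_bounded u" shows "0 \<le> conv K u x"
  unfolding conv_def using nonneg_bounded_nonneg[OF assms(2)] conv_kernelD(4)[OF assms(1)]
  by (intro integral_nonneg_AE) auto

lemma conv_bound:
  assumes "conv_kernel K" "nonneg_bounded u" "\<And>x. u x \<le> B"
  shows "conv K u x \<le> mass K * B"
proof -
  have "conv K u x \<le> (\<integral>y. K (x - y) * B \<partial>lborel)"
    unfolding conv_def
    using assms(3) conv_kernelD(4)[OF assms(1)] conv_integrable[OF assms(1,2)] conv_kernel_shift(1)[OF assms(1)]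
    by (intro integral_mono) (auto intro: mult_left_mono)
  then show ?thesis using conv_kernel_shift(2)[OF assms(1)] by simp
qed

lemma conv_meas:
  assumes [measurable]: "K \<in> borel_measurable borel" "u \<in> borel_measurable borel"
  shows "conv K u \<in> borel_measurable borel"
  unfolding conv_def[abs_def] by measurable

lemma conv_nonneg_bounded:
  assumes "conv_kernel K" "nonneg_bounded u" shows "nonneg_bounded (conv K u)"
proof -
  obtain B where "\<And>x. u x \<le> B" "0 \<le> B" using nonneg_bounded_bound[OF assms(2)] by blast
  then show ?thesis
    using conv_bound[OF assms] conv_nonneg[OF assms]  conv_meas[OF conv_kernelD(3)[OF assms(1)] nonneg_bounded_meas[OF assms(2)]]
    by (intro nonneg_boundedI[of _ "mass K * B"]) auto
qed

text \<open>The adjoint of convolution with \<open>K\<close> is convolution with the reflected kernel.\<close>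

lemma conv_dual:
  assumes "conv_kernel K" "nonneg_bounded u" "nonneg_bounded v"
  shows "(\<integral>\<^sup>+x. ennreal (conv K u x * v x) \<partial>lborel)
       = (\<integral>\<^sup>+y. ennreal (u y * conv (\<lambda>t. K (- t)) v y) \<partial>lborel)"
proof -
  note [measurable] = nonneg_bounded_meas[OF assms(2)] nonneg_bounded_meas[OF assms(3)] conv_kernelD(3)[OF assms(1)]
  have "(\<integral>\<^sup>+x. ennreal (conv K u x * v x) \<partial>lborel)
      = (\<integral>\<^sup>+x. (\<integral>\<^sup>+y. ennreal (K (x - y)) * ennreal (u y) * ennreal (v x) \<partial>lborel) \<partial>lborel)"
    using conv_nonneg[OF assms(1,2)] nonneg_bounded_nonneg[OF assms(3)]
    by (simp add: ennreal_mult conv_eq_nn[OF assms(1,2)] nn_integral_multc)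
  also have "\<dots> = (\<integral>\<^sup>+y. (\<integral>\<^sup>+x. ennreal (K (x - y)) * ennreal (u y) * ennreal (v x) \<partial>lborel) \<partial>lborel)"
    by (rule lborel_pair.Fubini'[symmetric]) measurable
  also have "\<dots> = (\<integral>\<^sup>+y. ennreal (u y) * (\<integral>\<^sup>+x. ennreal (K (- (y - x))) * ennreal (v x) \<partial>lborel) \<partial>lborel)"
    by (subst nn_integral_cmult[symmetric]) (auto simp: ac_simps)
  also have "\<dots> = (\<integral>\<^sup>+y. ennreal (u y * conv (\<lambda>t. K (- t)) v y) \<partial>lborel)"
    using conv_nonneg[OF conv_kernel_reflect(1)[OF assms(1)] assms(3)] nonneg_bounded_nonneg[OF assms(2)]
    by (simp add: ennreal_mult conv_eq_nn[OF conv_kernel_reflect(1)[OF assms(1)] assms(3)])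
  finally show ?thesis .
qed

lemma nonneg_bounded_const: "0 \<le> c \<Longrightarrow> nonneg_bounded (\<lambda>_. c)"
  by (intro nonneg_boundedI[of _ c]) auto

lemma conv_one: "conv_kernel K \<Longrightarrow> conv K (\<lambda>_. 1) = (\<lambda>_. mass K)"
  using conv_kernel_shift(2) by (auto simp: conv_def)

lemma conv_total:
  assumes "conv_kernel K" "nonneg_bounded u"
  shows "(\<integral>\<^sup>+x. ennreal (conv K u x) \<partial>lborel) = ennreal (mass K) * (\<integral>\<^sup>+x. ennreal (u x) \<partial>lborel)"
proof -
  note [measurable] = nonneg_bounded_meas[OF assms(2)]
  have "(\<integral>\<^sup>+x. ennreal (conv K u x) \<partial>lborel) = (\<integral>\<^sup>+x. ennreal (conv K u x * 1) \<partial>lborel)" by simp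
  also have "\<dots> = (\<integral>\<^sup>+y. ennreal (u y * conv (\<lambda>t. K (- t)) (\<lambda>_. 1) y) \<partial>lborel)"
    by (rule conv_dual[OF assms nonneg_bounded_const]) simp
  also have "\<dots> = (\<integral>\<^sup>+y. ennreal (mass K) * ennreal (u y) \<partial>lborel)"
    unfolding conv_one[OF conv_kernel_reflect(1)[OF assms(1)]] conv_kernel_reflect(2)[OF assms(1)]
    using nonneg_bounded_nonneg[OF assms(2)] mass_nonneg[OF assms(1)] by (simp add: ennreal_mult mult.commute)
  also have "\<dots> = ennreal (mass K) * (\<integral>\<^sup>+x. ennreal (u x) \<partial>lborel)"
    by (rule nn_integral_cmult) measurable
  finally show ?thesis .
qed

lemma conv_kernel_conv:
  assumes "conv_kernel K" "conv_kernel L" shows "conv_kernel (conv K L)" "mass (conv K L) = mass K * mass L"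
proof -
  have n: "nonneg_bounded (conv K L)" using conv_nonneg_bounded[OF assms(1) conv_kernelD(1)[OF assms(2)]] .
  note [measurable] = nonneg_bounded_meas[OF n]
  have L: "(\<integral>\<^sup>+x. ennreal (L x) \<partial>lborel) = ennreal (mass L)"
    unfolding mass_def using conv_kernelD[OF assms(2)] by (intro nn_integral_eq_integral) auto
  have t: "(\<integral>\<^sup>+x. ennreal (conv K L x) \<partial>lborel) = ennreal (mass K * mass L)"
    using conv_total[OF assms(1) conv_kernelD(1)[OF assms(2)]] L mass_nonneg[OF assms(1)] mass_nonneg[OF assms(2)]
    by (simp add: ennreal_mult)
  have hb: "has_bochner_integral lborel (conv K L) (mass K * mass L)"
    using t nonneg_bounded_nonneg[OF n] mass_nonneg[OF assms(1)] mass_nonneg[OF assms(2)]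
    by (intro has_bochner_integral_nn_integral) auto
  then show "conv_kernel (conv K L)" "mass (conv K L) = mass K * mass L"
    using n by (auto simp: conv_kernel_def mass_def has_bochner_integral_iff)
qed

lemma conv_assoc:
  assumes "conv_kernel K" "conv_kernel L" "nonneg_bounded u"
  shows "conv (conv K L) u = conv K (conv L u)"
proof
  fix x
  note [measurable] = nonneg_bounded_meas[OF assms(3)] conv_kernelD(3)[OF assms(1)] conv_kernelD(3)[OF assms(2)]
  have "ennreal (conv (conv K L) u x)
      = (\<integral>\<^sup>+y. (\<integral>\<^sup>+z. ennreal (K (x - y - z)) * ennreal (L z) * ennreal (u y) \<partial>lborel) \<partial>lborel)"
    unfolding conv_eq_nn[OF conv_kernel_conv(1)[OF assms(1,2)] assms(3)]
      conv_eq_nn[OF assms(1) conv_kernelD(1)[OF assms(2)]]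
    by (simp add: nn_integral_multc)
  also have "\<dots> = (\<integral>\<^sup>+y. (\<integral>\<^sup>+z. ennreal (K (x - z)) * ennreal (L (z - y)) * ennreal (u y) \<partial>lborel) \<partial>lborel)"
  proof (rule nn_integral_cong)
    fix y
    show "(\<integral>\<^sup>+z. ennreal (K (x - y - z)) * ennreal (L z) * ennreal (u y) \<partial>lborel)
        = (\<integral>\<^sup>+z. ennreal (K (x - z)) * ennreal (L (z - y)) * ennreal (u y) \<partial>lborel)"
      using nn_integral_real_affine[of "\<lambda>z. ennreal (K (x - y - z)) * ennreal (L z) * ennreal (u y)" 1 "-y"]
      by (simp add: algebra_simps)
  qed
  also have "\<dots> = (\<integral>\<^sup>+z. (\<integral>\<^sup>+y. ennreal (K (x - z)) * ennreal (L (z - y)) * ennreal (u y) \<partial>lborel) \<partial>lborel)"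
    by (rule lborel_pair.Fubini') measurable
  also have "\<dots> = ennreal (conv K (conv L u) x)"
    unfolding conv_eq_nn[OF assms(1) conv_nonneg_bounded[OF assms(2,3)]] conv_eq_nn[OF assms(2,3)]
    by (subst nn_integral_cmult[symmetric]) (auto simp: ac_simps)
  finally show "conv (conv K L) u x = conv K (conv L u) x"
    using conv_nonneg[OF conv_kernel_conv(1)[OF assms(1,2)] assms(3)]
      conv_nonneg[OF assms(1) conv_nonneg_bounded[OF assms(2,3)]] by simp
qed

lemma conv_shift: "conv K (\<lambda>y. u (s + y)) x = conv K u (s + x)"
  unfolding conv_def using lborel_integral_real_affine[of 1 "\<lambda>y. K (s + x - y) * u y" s]
  by (simp add: algebra_simps)

lemma conv_reflect: "conv (\<lambda>t. K (- t)) (\<lambda>t. L (- t)) x = conv K L (- x)"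
  unfolding conv_def using lborel_integral_real_affine[of "-1" "\<lambda>y. K (- x - y) * L y" 0]
  by (simp add: algebra_simps)

lemma power_integral_shift:
  assumes "nonneg_bounded u" shows "power_integral r (\<lambda>y. u (s + y)) = power_integral r u"
proof -
  note [measurable] = nonneg_bounded_meas[OF assms]
  show ?thesis
    unfolding power_integral_def using nn_integral_real_affine[of "\<lambda>x. ennreal (u x powr r)" 1 s] by simp
qed

text \<open>Jensen's inequality for the measure \<open>K (x - y) dy\<close>. It follows by integrating Young's
  inequality at the mean value \<open>t\<close> of \<open>u\<close>.\<close>

lemma conv_powr_le:
  assumes K: "conv_kernel K" and u: "nonneg_bounded u" and r: "1 < r"
  shows "conv K u x powr r \<le> mass K powr (r - 1) * conv K (\<lambda>y. u y powr r) x"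
proof -
  define c where "c = conv K u x"
  define m where "m = mass K"
  have ur: "nonneg_bounded (\<lambda>y. u y powr r)" using nonneg_bounded_powr[OF u] r by simp
  have c0: "0 \<le> c" and m0: "0 \<le> m" using conv_nonneg[OF K u] mass_nonneg[OF K] by (auto simp: c_def m_def)
  have e0: "0 \<le> conv K (\<lambda>y. u y powr r) x" by (rule conv_nonneg[OF K ur])
  obtain B where "\<And>x. u x \<le> B" "0 \<le> B" using nonneg_bounded_bound[OF u] by blast
  then have cm: "c \<le> m * B" using conv_bound[OF K u, of B x] by (simp add: c_def m_def)
  show ?thesis
  proof (cases "m = 0 \<or> c = 0")
    case True
    then have "c = 0" using cm c0 by auto
    then show ?thesis using e0 by (simp add: c_def)
  next
    case False
    then have m: "0 < m" and c: "0 < c" using m0 c0 by auto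
    define t where "t = c / m"
    have t: "0 < t" using m c by (simp add: t_def)
    have "t powr (r - 1) * c = (\<integral>y. K (x - y) * u y * t powr (r - 1) \<partial>lborel)"
      by (simp add: c_def conv_def mult.commute)
    also have "\<dots> \<le> (\<integral>y. K (x - y) * (u y powr r) / r + K (x - y) * ((1 - 1 / r) * t powr r) \<partial>lborel)"
    proof (rule integral_mono)
      show "integrable lborel (\<lambda>y. K (x - y) * u y * t powr (r - 1))"
        using conv_integrable[OF K u] by simp
      show "integrable lborel (\<lambda>y. K (x - y) * (u y powr r) / r + K (x - y) * ((1 - 1 / r) * t powr r))"
        using conv_integrable[OF K ur] conv_kernel_shift(1)[OF K] by auto
      fix y
      have "K (x - y) * (u y * t powr (r - 1)) \<le> K (x - y) * (u y powr r / r + (1 - 1 / r) * t powr r)"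
        using young_powr[OF r nonneg_bounded_nonneg[OF u], of t y] t conv_kernelD(4)[OF K] by (intro mult_left_mono) auto
      then show "K (x - y) * u y * t powr (r - 1)
          \<le> K (x - y) * (u y powr r) / r + K (x - y) * ((1 - 1 / r) * t powr r)"
        by (simp add: algebra_simps)
    qed
    also have "\<dots> = conv K (\<lambda>y. u y powr r) x / r + m * ((1 - 1 / r) * t powr r)"
      using conv_integrable[OF K ur] conv_kernel_shift(1,2)[OF K]
      by (subst Bochner_Integration.integral_add) (auto simp: conv_def m_def)
    finally have 1: "t powr (r - 1) * c \<le> conv K (\<lambda>y. u y powr r) x / r + m * ((1 - 1 / r) * t powr r)" .
    have "t powr (r - 1) * c = m * t powr r"
      using t m by (simp add: t_def powr_diff field_simps)
    with 1 have "m * t powr r / r \<le> conv K (\<lambda>y. u y powr r) x / r" by (simp add: algebra_simps)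
    then have "m * t powr r \<le> conv K (\<lambda>y. u y powr r) x" using r by (simp add: divide_le_cancel)
    then have "m powr (r - 1) * (m * t powr r) \<le> m powr (r - 1) * conv K (\<lambda>y. u y powr r) x"
      by (rule mult_left_mono) simp
    also have "m powr (r - 1) * (m * t powr r) = c powr r"
      using m c by (simp add: t_def powr_divide powr_diff)
    finally show ?thesis by (simp add: c_def m_def)
  qed
qed

text \<open>Young's convolution inequality \<open>L\<^sup>1 * L\<^sup>r \<subseteq> L\<^sup>r\<close>.\<close>

lemma power_integral_conv_le:
  assumes K: "conv_kernel K" and u: "nonneg_bounded u" and r: "1 < r"
  shows "power_integral r (conv K u) \<le> ennreal (mass K powr r) * power_integral r u"
proof -
  have ur: "nonneg_bounded (\<lambda>y. u y powr r)" using nonneg_bounded_powr[OF u] r by simp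
  note [measurable] = nonneg_bounded_meas[OF conv_nonneg_bounded[OF K ur]]
  have "power_integral r (conv K u) \<le> (\<integral>\<^sup>+x. ennreal (mass K powr (r - 1)) * ennreal (conv K (\<lambda>y. u y powr r) x) \<partial>lborel)"
    unfolding power_integral_def using conv_powr_le[OF K u r] conv_nonneg[OF K ur]
    by (intro nn_integral_mono) (simp add: ennreal_mult[symmetric])
  also have "\<dots> = ennreal (mass K powr (r - 1)) * (ennreal (mass K) * power_integral r u)"
    unfolding power_integral_def by (subst nn_integral_cmult) (auto simp: conv_total[OF K ur])
  also have "\<dots> = ennreal (mass K powr r) * power_integral r u"
    using mass_nonneg[OF K] by (cases "mass K = 0") (auto simp: mult.assoc[symmetric] ennreal_mult[symmetric] powr_diff)
  finally show ?thesis .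
qed

lemma power_integral_interpolate:
  assumes g: "nonneg_bounded g" "\<And>x. g x \<le> c" and rq: "r \<le> q"
  shows "power_integral q g \<le> ennreal (c powr (q - r)) * power_integral r g"
proof -
  note [measurable] = nonneg_bounded_meas[OF g(1)]
  have "g x powr q \<le> c powr (q - r) * g x powr r" for x
  proof -
    have "g x powr q = g x powr (q - r) * g x powr r"
      by (simp add: powr_add[symmetric])
    also have "\<dots> \<le> c powr (q - r) * g x powr r"
      using g rq nonneg_bounded_nonneg[OF g(1)] by (intro mult_right_mono powr_mono2) auto
    finally show ?thesis .
  qed
  then have "power_integral q g \<le> (\<integral>\<^sup>+x. ennreal (c powr (q - r)) * ennreal (g x powr r) \<partial>lborel)"
    unfolding power_integral_def by (intro nn_integral_mono) (simp add: ennreal_mult[symmetric])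
  also have "\<dots> = ennreal (c powr (q - r)) * power_integral r g"
    unfolding power_integral_def by (rule nn_integral_cmult) measurable
  finally show ?thesis .
qed

section \<open>One-sided exponential kernels\<close>

text \<open>Up to sign, convolution with \<open>exp_kernel a\<close> inverts the operator \<open>u' - a u\<close> on bounded functions. The
  kernel is the exponential \<open>exp (a x)\<close> on the half-line where it decays; the value \<open>0\<close> at the
  origin is immaterial.\<close>

definition exp_kernel :: "real \<Rightarrow> real \<Rightarrow> real" where
  "exp_kernel a x = (if a * x < 0 then exp (a * x) else 0)"

lemma exp_kernel_reflect: "(\<lambda>t. exp_kernel a (- t)) = exp_kernel (- a)"
  by (auto simp: exp_kernel_def)

lemma exp_kernel_meas [measurable]: "exp_kernel a \<in> borel_measurable borel"
  unfolding exp_kernel_def[abs_def] by measurable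

lemma exp_kernel_conv_kernel:
  assumes "a \<noteq> 0" shows "conv_kernel (exp_kernel a)" "mass (exp_kernel a) = 1 / \<bar>a\<bar>"
proof -
  have neg: "conv_kernel (exp_kernel a) \<and> mass (exp_kernel a) = 1 / \<bar>a\<bar>" if a: "a < 0" for a
  proof -
    have n: "nonneg_bounded (exp_kernel a)" by (rule nonneg_boundedI[of _ 1]) (auto simp: exp_kernel_def)
    have "(\<integral>\<^sup>+x. ennreal (exp_kernel a x) \<partial>lborel) = (\<integral>\<^sup>+x. ennreal (exp (a * x)) * indicator {0..} x \<partial>lborel)"
      using AE_lborel_singleton[of 0] a
      by (intro nn_integral_cong_AE) (auto simp: exp_kernel_def indicator_def mult_less_0_iff elim!: eventually_mono)
    also have "\<dots> = ennreal (0 - exp (a * 0) / a)"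
    proof (rule nn_integral_FTC_atLeast[where F = "\<lambda>x. exp (a * x) / a"])
      show "((\<lambda>x. exp (a * x) / a) has_real_derivative exp (a * x)) (at x)" for x
        using a by (auto intro!: derivative_eq_intros)
      show "((\<lambda>x. exp (a * x) / a) \<longlongrightarrow> 0) at_top"
      proof -
        have "filterlim (\<lambda>x. a * x) at_bot at_top"
          using a by (intro filterlim_tendsto_neg_mult_at_bot[OF tendsto_const]) (auto intro: filterlim_ident)
        then have "((\<lambda>x. exp (a * x)) \<longlongrightarrow> 0) at_top" by (rule filterlim_compose[OF exp_at_bot])
        then show ?thesis by (rule tendsto_divide_zero)
      qed
    qed auto
    also have "\<dots> = ennreal (1 / \<bar>a\<bar>)" using a by simp
    finally have "has_bochner_integral lborel (exp_kernel a) (1 / \<bar>a\<bar>)"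
      by (intro has_bochner_integral_nn_integral) (auto simp: exp_kernel_def)
    then show ?thesis using n by (auto simp: conv_kernel_def mass_def has_bochner_integral_iff)
  qed
  have "conv_kernel (exp_kernel a) \<and> mass (exp_kernel a) = 1 / \<bar>a\<bar>"
  proof (cases "a < 0")
    case False
    then have "- a < 0" using assms by simp
    then show ?thesis using neg[of "- a"] conv_kernel_reflect[of "exp_kernel (- a)"] by (simp add: exp_kernel_reflect)
  qed (use neg in auto)
  then show "conv_kernel (exp_kernel a)" "mass (exp_kernel a) = 1 / \<bar>a\<bar>" by auto
qed

lemma exp_kernel_translation:
  assumes "a \<noteq> 0"
  shows "(\<integral>x. \<bar>exp_kernel a (h + x) - exp_kernel a x\<bar> \<partial>lborel) \<le> 2 * \<bar>h\<bar>"
proof -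
  have *: "(\<integral>x. \<bar>exp_kernel a (h + x) - exp_kernel a x\<bar> \<partial>lborel) \<le> 2 * h" if a: "a < 0" and h: "0 \<le> h" for a h
  proof -
    have i: "integrable lborel (exp_kernel a)" using conv_kernelD(2)[OF exp_kernel_conv_kernel(1)] a by simp
    have i': "integrable lborel (\<lambda>x. exp_kernel a (h + x))"
      using lborel_integrable_real_affine[OF i, of 1 h] by simp
    have le: "\<bar>exp_kernel a (h + x) - exp_kernel a x\<bar> \<le> indicator {-h..0} x + \<bar>a\<bar> * h * exp_kernel a x" for x
    proof (cases "0 < x")
      case True
      then have "a * (h + x) < 0" "a * x < 0" using a h by (auto intro: mult_neg_pos)
      then have "exp_kernel a (h + x) - exp_kernel a x = - ((1 - exp (a * h)) * exp (a * x))"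
        by (simp add: exp_kernel_def distrib_left exp_add left_diff_distrib)
      then have "\<bar>exp_kernel a (h + x) - exp_kernel a x\<bar> = (1 - exp (a * h)) * exp (a * x)"
        using a h by (simp add: abs_mult mult_nonpos_nonneg)
      also have "\<dots> \<le> (\<bar>a\<bar> * h) * exp (a * x)"
      proof (rule mult_right_mono)
        have "\<bar>a\<bar> * h = - (a * h)" using a by simp
        then show "1 - exp (a * h) \<le> \<bar>a\<bar> * h" using exp_ge_add_one_self[of "a * h"] by linarith
      qed simp
      finally show ?thesis using True a by (simp add: exp_kernel_def mult_less_0_iff)
    next
      case False
      then have "exp_kernel a x = 0" using a by (simp add: exp_kernel_def mult_less_0_iff)
      moreover have "exp_kernel a (h + x) \<le> indicator {-h..0} x" "0 \<le> exp_kernel a (h + x)"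
        using False a by (auto simp: exp_kernel_def indicator_def mult_less_0_iff intro: mult_nonpos_nonneg)
      ultimately show ?thesis by simp
    qed
    have "(\<integral>x. \<bar>exp_kernel a (h + x) - exp_kernel a x\<bar> \<partial>lborel)
        \<le> (\<integral>x. indicator {-h..0} x + \<bar>a\<bar> * h * exp_kernel a x \<partial>lborel)"
      using i i' by (intro integral_mono le Bochner_Integration.integrable_add integrable_real_indicator) (auto simp: emeasure_lborel_Icc_eq)
    also have "\<dots> = h + \<bar>a\<bar> * h * mass (exp_kernel a)"
      using i h by (subst Bochner_Integration.integral_add) (auto simp: mass_def)
    finally show ?thesis using a exp_kernel_conv_kernel(2)[of a] by simp
  qed
  have **: "(\<integral>x. \<bar>exp_kernel a (h + x) - exp_kernel a x\<bar> \<partial>lborel) \<le> 2 * \<bar>h\<bar>" if a: "a < 0" for a h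
  proof (cases "0 \<le> h")
    case True
    then show ?thesis using *[OF a] by simp
  next
    case False
    have "(\<integral>x. \<bar>exp_kernel a (h + x) - exp_kernel a x\<bar> \<partial>lborel) = (\<integral>x. \<bar>exp_kernel a (- h + x) - exp_kernel a x\<bar> \<partial>lborel)"
      using lborel_integral_real_affine[of 1 "\<lambda>x. \<bar>exp_kernel a (h + x) - exp_kernel a x\<bar>" "- h"]
      by (simp add: abs_minus_commute)
    then show ?thesis using *[OF a, of "- h"] False by simp
  qed
  show ?thesis
  proof (cases "a < 0")
    case False
    then have "- a < 0" using assms by simp
    have "(\<integral>x. \<bar>exp_kernel a (h + x) - exp_kernel a x\<bar> \<partial>lborel) = (\<integral>x. \<bar>exp_kernel (- a) (- h + x) - exp_kernel (- a) x\<bar> \<partial>lborel)"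
      using lborel_integral_real_affine[of "- 1" "\<lambda>x. \<bar>exp_kernel a (h + x) - exp_kernel a x\<bar>" 0]
      unfolding exp_kernel_reflect[of a, symmetric] by simp
    then show ?thesis using **[OF \<open>- a < 0\<close>, of "- h"] by simp
  qed (rule **)
qed

text \<open>Convolution with a kernel preserves the modulus of continuity of translations in \<open>L\<^sup>1\<close>, up to the mass.\<close>

lemma conv_translation:
  assumes K: "conv_kernel K" and L: "conv_kernel L"
  shows "(\<integral>x. \<bar>conv K L (h + x) - conv K L x\<bar> \<partial>lborel)
       \<le> mass K * (\<integral>x. \<bar>L (h + x) - L x\<bar> \<partial>lborel)"
proof -
  define D where "D = (\<lambda>x. \<bar>L (h + x) - L x\<bar>)"
  note [measurable] = conv_kernelD(3)[OF L]
  obtain B where B: "\<And>x. L x \<le> B" using nonneg_bounded_bound[OF conv_kernelD(1)[OF L]] by blast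
  have n: "nonneg_bounded D"
  proof (rule nonneg_boundedI[of _ B])
    show "D x \<le> B" for x
      using B[of x] B[of "h + x"] conv_kernelD(4)[OF L, of x] conv_kernelD(4)[OF L, of "h + x"]
      unfolding D_def by linarith
  qed (auto simp: D_def)
  have iLh: "integrable lborel (\<lambda>x. L (h + x))"
    using lborel_integrable_real_affine[OF conv_kernelD(2)[OF L], of 1 h] by simp
  then have kD: "conv_kernel D" using n conv_kernelD(2)[OF L] by (auto simp: conv_kernel_def D_def)
  have nLh: "nonneg_bounded (\<lambda>x. L (h + x))" using nonneg_bounded_affine[OF conv_kernelD(1)[OF L], of h 1] by simp
  have le: "\<bar>conv K L (h + x) - conv K L x\<bar> \<le> conv K D x" for x
  proof -
    have "conv K L (h + x) - conv K L x = conv K (\<lambda>y. L (h + y)) x - conv K L x"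
      by (simp only: conv_shift)
    also have "\<dots> = (\<integral>y. K (x - y) * (L (h + y) - L y) \<partial>lborel)"
      unfolding conv_def right_diff_distrib
      by (intro Bochner_Integration.integral_diff[symmetric] conv_integrable K nLh conv_kernelD(1)[OF L])
    also have "\<bar>\<dots>\<bar> \<le> (\<integral>y. \<bar>K (x - y) * (L (h + y) - L y)\<bar> \<partial>lborel)" by (rule integral_abs_bound)
    also have "\<dots> = conv K D x" using conv_kernelD(4)[OF K] by (simp add: conv_def D_def abs_mult)
    finally show ?thesis .
  qed
  have i: "integrable lborel (conv K L)" using conv_kernelD(2)[OF conv_kernel_conv(1)[OF K L]] .
  have "(\<integral>x. \<bar>conv K L (h + x) - conv K L x\<bar> \<partial>lborel) \<le> (\<integral>x. conv K D x \<partial>lborel)"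
    using i lborel_integrable_real_affine[OF i, of 1 h] conv_kernelD(2)[OF conv_kernel_conv(1)[OF K kD]]
    by (intro integral_mono le) auto
  also have "\<dots> = mass K * mass D" using conv_kernel_conv(2)[OF K kD] by (simp add: mass_def)
  finally show ?thesis by (simp add: mass_def D_def)
qed

section \<open>Weak derivatives of convolutions\<close>

text \<open>Weak derivatives of the functions considered here are bounded Borel functions of
  arbitrary sign.\<close>

definition bounded_borel :: "(real \<Rightarrow> real) \<Rightarrow> bool" where
  "bounded_borel u \<longleftrightarrow> u \<in> borel_measurable borel \<and> (\<exists>B. \<forall>x. \<bar>u x\<bar> \<le> B)"

lemma bounded_borel_meas: "bounded_borel u \<Longrightarrow> u \<in> borel_measurable borel" by (simp add: bounded_borel_def)

lemma nonneg_bounded_imp_bounded_borel: "nonneg_bounded u \<Longrightarrow> bounded_borel u" by (auto simp: nonneg_bounded_def bounded_borel_def)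

lemma bounded_borel_lincomb:
  assumes "bounded_borel u" "bounded_borel v" shows "bounded_borel (\<lambda>x. \<alpha> * u x + \<beta> * v x)"
proof -
  note [measurable] = bounded_borel_meas[OF assms(1)] bounded_borel_meas[OF assms(2)]
  obtain B C where B: "\<And>x. \<bar>u x\<bar> \<le> B" "\<And>x. \<bar>v x\<bar> \<le> C" using assms by (auto simp: bounded_borel_def)
  have "\<bar>\<alpha> * u x + \<beta> * v x\<bar> \<le> \<bar>\<alpha>\<bar> * B + \<bar>\<beta>\<bar> * C" for x
  proof -
    have "\<bar>\<alpha> * u x + \<beta> * v x\<bar> \<le> \<bar>\<alpha>\<bar> * \<bar>u x\<bar> + \<bar>\<beta>\<bar> * \<bar>v x\<bar>"
      unfolding abs_mult[symmetric] by (rule abs_triangle_ineq)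
    also have "\<dots> \<le> \<bar>\<alpha>\<bar> * B + \<bar>\<beta>\<bar> * C" using B by (intro add_mono mult_left_mono) auto
    finally show ?thesis .
  qed
  then show ?thesis unfolding bounded_borel_def by auto
qed

lemma bounded_borel_times_integrable:
  assumes u: "bounded_borel u" and v: "integrable lborel v"
  shows "integrable lborel (\<lambda>x. u x * v x)"
proof -
  obtain B where B: "\<And>x. \<bar>u x\<bar> \<le> B" using u by (auto simp: bounded_borel_def)
  have B0: "0 \<le> B" using B[of 0] by linarith
  have [measurable]: "u \<in> borel_measurable borel" "v \<in> borel_measurable borel"
    using bounded_borel_meas[OF u] v by auto
  show ?thesis
    by (rule Bochner_Integration.integrable_bound[OF integrable_mult_right[OF v, of B]])
      (use B B0 in \<open>auto simp: abs_mult intro!: mult_right_mono\<close>)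
qed

lemma bounded_borel_locally_integrable:
  assumes "bounded_borel u" shows "locally_integrable u"
  unfolding locally_integrable_def set_integrable_def
proof (intro allI impI)
  fix K :: "real set" assume K: "compact K"
  note [measurable] = bounded_borel_meas[OF assms] borel_compact[OF K]
  have "integrable lborel (\<lambda>x. u x * indicator K x)"
    using emeasure_compact_finite[OF K] borel_compact[OF K]
    by (intro bounded_borel_times_integrable[OF assms] integrable_real_indicator) auto
  then have "integrable lebesgue (\<lambda>x. u x * indicator K x)"
    by (subst integrable_completion) auto
  then show "integrable lebesgue (\<lambda>x. indicator K x *\<^sub>R u x)" by (simp add: mult.commute)
qed

lemma test_function_deriv:
  assumes "test_function \<phi>" shows "test_function (deriv \<phi>)"
proof -
  have d: "(deriv ^^ n) (deriv \<phi>) differentiable (at x)" for n x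
    using assms funpow_swap1[of deriv n \<phi>] unfolding test_function_def
    by (metis funpow.simps(2) comp_apply)
  have z: "deriv \<phi> x = 0" if "x \<notin> closure {x. \<phi> x \<noteq> 0}" for x
  proof -
    have "open (- closure {x. \<phi> x \<noteq> 0})" by (intro open_Compl closed_closure)
    then have "eventually (\<lambda>y. y \<in> - closure {x. \<phi> x \<noteq> 0}) (nhds x)"
      using that by (intro eventually_nhds_in_open) auto
    then have "eventually (\<lambda>y. \<phi> y = (\<lambda>_. 0) y) (nhds x)"
      by (rule eventually_mono) (use closure_subset[of "{x. \<phi> x \<noteq> 0}"] in auto)
    then have "deriv \<phi> x = deriv (\<lambda>_. 0) x" by (rule deriv_cong_ev) simp
    then show ?thesis by simp
  qed
  then have "{x. deriv \<phi> x \<noteq> 0} \<subseteq> closure {x. \<phi> x \<noteq> 0}" by blast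
  then have "closure {x. deriv \<phi> x \<noteq> 0} \<subseteq> closure {x. \<phi> x \<noteq> 0}"
    using closed_closure by (rule closure_minimal)
  then have "closure {x. \<phi> x \<noteq> 0} \<inter> closure {x. deriv \<phi> x \<noteq> 0} = closure {x. deriv \<phi> x \<noteq> 0}"
    by (rule inf.absorb2)
  moreover have "compact (closure {x. \<phi> x \<noteq> 0} \<inter> closure {x. deriv \<phi> x \<noteq> 0})"
    using assms closed_closure unfolding test_function_def by (intro compact_Int_closed) auto
  ultimately have "compact (closure {x. deriv \<phi> x \<noteq> 0})" by (simp only:)
  then show ?thesis using d by (simp add: test_function_def)
qed

lemma test_function_deriv_funpow:
  assumes "test_function \<phi>" shows "test_function ((deriv ^^ k) \<phi>)"
  by (induction k) (auto intro: test_function_deriv assms)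

lemma test_function_DERIV:
  assumes "test_function \<phi>" shows "(\<phi> has_real_derivative deriv \<phi> x) (at x)"
proof -
  have "(deriv ^^ 0) \<phi> differentiable (at x)" using assms unfolding test_function_def by blast
  then show ?thesis
    by (simp add: DERIV_deriv_iff_real_differentiable)
qed

lemma test_function_continuous:
  assumes "test_function \<phi>" shows "isCont \<phi> x" "\<phi> \<in> borel_measurable borel"
proof -
  show *: "isCont \<phi> x" for x using DERIV_isCont[OF test_function_DERIV[OF assms]] .
  show "\<phi> \<in> borel_measurable borel"
    by (intro borel_measurable_continuous_onI continuous_at_imp_continuous_on) (use * in auto)
qed

lemma test_function_support:
  assumes "test_function \<phi>" obtains R where "0 < R" "\<And>x. R \<le> \<bar>x\<bar> \<Longrightarrow> \<phi> x = 0"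
proof -
  have "bounded (closure {x. \<phi> x \<noteq> 0})"
    using assms by (auto simp: test_function_def intro: compact_imp_bounded)
  then obtain R where R: "\<And>x. x \<in> closure {x. \<phi> x \<noteq> 0} \<Longrightarrow> \<bar>x\<bar> \<le> R"
    by (auto simp: bounded_iff)
  have "\<phi> x = 0" if "\<bar>R\<bar> + 1 \<le> \<bar>x\<bar>" for x
    using R[of x] that closure_subset[of "{x. \<phi> x \<noteq> 0}"] by (cases "\<phi> x = 0") auto
  then show ?thesis by (intro that[of "\<bar>R\<bar> + 1"]) auto
qed

lemma test_function_integrable:
  assumes "test_function \<phi>" shows "integrable lborel \<phi>"
proof -
  obtain R where R: "0 < R" "\<And>x. R \<le> \<bar>x\<bar> \<Longrightarrow> \<phi> x = 0" using test_function_support[OF assms] by blast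
  have "integrable lborel (\<lambda>x. indicator {-R..R} x *\<^sub>R \<phi> x)"
    using test_function_continuous(1)[OF assms]
    by (intro borel_integrable_compact compact_Icc continuous_at_imp_continuous_on) auto
  also have "(\<lambda>x. indicator {-R..R} x *\<^sub>R \<phi> x) = \<phi>"
  proof
    fix x
    show "indicator {-R..R} x *\<^sub>R \<phi> x = \<phi> x"
    proof (cases "x \<in> {-R..R}")
      case False
      then have "R \<le> \<bar>x\<bar>" unfolding atLeastAtMost_iff by linarith
      then show ?thesis using R(2) by simp
    qed simp
  qed
  finally show ?thesis .
qed

lemma weak_deriv_bounded_borelI:
  assumes "bounded_borel u" "bounded_borel v"
    and eq: "\<And>\<phi>. test_function \<phi> \<Longrightarrow>
      (\<integral>x. u x * (deriv ^^ k) \<phi> x \<partial>lborel) = (-1) ^ k * (\<integral>x. v x * \<phi> x \<partial>lborel)"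
  shows "weak_deriv k u v"
  unfolding weak_deriv_def
proof (intro conjI allI impI bounded_borel_locally_integrable assms(1,2))
  fix \<phi> assume t: "test_function \<phi>"
  note [measurable] = bounded_borel_meas[OF assms(1)] bounded_borel_meas[OF assms(2)]
    test_function_continuous(2)[OF t] test_function_continuous(2)[OF test_function_deriv_funpow[OF t]]
  show "(\<integral>x. u x * (deriv ^^ k) \<phi> x \<partial>lebesgue) = (-1) ^ k * (\<integral>x. v x * \<phi> x \<partial>lebesgue)"
    using eq[OF t] by (simp add: integral_completion)
qed

lemma weak_derivD:
  assumes "weak_deriv k u v" "bounded_borel u" "bounded_borel v" "test_function \<phi>"
  shows "(\<integral>x. u x * (deriv ^^ k) \<phi> x \<partial>lborel) = (-1) ^ k * (\<integral>x. v x * \<phi> x \<partial>lborel)"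
proof -
  note [measurable] = bounded_borel_meas[OF assms(2)] bounded_borel_meas[OF assms(3)]
    test_function_continuous(2)[OF assms(4)] test_function_continuous(2)[OF test_function_deriv_funpow[OF assms(4)]]
  have "(\<integral>x. u x * (deriv ^^ k) \<phi> x \<partial>lebesgue) = (-1) ^ k * (\<integral>x. v x * \<phi> x \<partial>lebesgue)"
    using assms(1,4) unfolding weak_deriv_def by blast
  then show ?thesis by (simp add: integral_completion)
qed

lemma weak_deriv_lincomb:
  assumes w: "weak_deriv k u1 v1" "weak_deriv k u2 v2" and b: "bounded_borel u1" "bounded_borel v1" "bounded_borel u2" "bounded_borel v2"
  shows "weak_deriv k (\<lambda>x. \<alpha> * u1 x + \<beta> * u2 x) (\<lambda>x. \<alpha> * v1 x + \<beta> * v2 x)"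
proof (rule weak_deriv_bounded_borelI)
  fix \<phi> assume t: "test_function \<phi>"
  have sum: "(\<integral>x. (\<alpha> * f x + \<beta> * g x) * \<psi> x \<partial>lborel)
      = \<alpha> * (\<integral>x. f x * \<psi> x \<partial>lborel) + \<beta> * (\<integral>x. g x * \<psi> x \<partial>lborel)"
    if "bounded_borel f" "bounded_borel g" "test_function \<psi>" for f g \<psi>
    using bounded_borel_times_integrable[OF that(1) test_function_integrable[OF that(3)]]
      bounded_borel_times_integrable[OF that(2) test_function_integrable[OF that(3)]]
    by (simp add: distrib_right mult.assoc)
  show "(\<integral>x. (\<alpha> * u1 x + \<beta> * u2 x) * (deriv ^^ k) \<phi> x \<partial>lborel)
      = (-1) ^ k * (\<integral>x. (\<alpha> * v1 x + \<beta> * v2 x) * \<phi> x \<partial>lborel)"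
    unfolding sum[OF b(1,3) test_function_deriv_funpow[OF t]] sum[OF b(2,4) t]
      weak_derivD[OF w(1) b(1,2) t] weak_derivD[OF w(2) b(3,4) t]
    by (simp add: algebra_simps)
qed (intro bounded_borel_lincomb b)+

lemma weak_deriv_trans:
  assumes "weak_deriv 1 u v" "weak_deriv 1 v w" shows "weak_deriv 2 u w"
  using assms test_function_deriv unfolding weak_deriv_def
  by (auto simp: numeral_2_eq_2)

lemma conv_Fubini:
  assumes K: "conv_kernel K" and u: "nonneg_bounded u" and \<psi>: "integrable lborel \<psi>"
  shows "(\<integral>x. conv K u x * \<psi> x \<partial>lborel) = (\<integral>y. u y * (\<integral>x. K (x - y) * \<psi> x \<partial>lborel) \<partial>lborel)"
proof -
  have [measurable]: "K \<in> borel_measurable borel" "u \<in> borel_measurable borel" "\<psi> \<in> borel_measurable borel"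
    using conv_kernelD(3)[OF K] nonneg_bounded_meas[OF u] \<psi> by auto
  have int: "integrable (lborel \<Otimes>\<^sub>M lborel) (\<lambda>(x, y). K (x - y) * u y * \<psi> x)"
  proof (rule lborel_pair.Fubini_integrable)
    have "(\<integral>y. norm (K (x - y) * u y * \<psi> x) \<partial>lborel) = conv K u x * \<bar>\<psi> x\<bar>" for x
      using conv_kernelD(4)[OF K] nonneg_bounded_nonneg[OF u] by (simp add: abs_mult conv_def)
    then show "integrable lborel (\<lambda>x. \<integral>y. norm (case (x, y) of (x, y) \<Rightarrow> K (x - y) * u y * \<psi> x) \<partial>lborel)"
      using bounded_borel_times_integrable[OF nonneg_bounded_imp_bounded_borel[OF conv_nonneg_bounded[OF K u]] integrable_abs[OF \<psi>]] by simp
    show "AE x in lborel. integrable lborel (\<lambda>y. case (x, y) of (x, y) \<Rightarrow> K (x - y) * u y * \<psi> x)"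
      using conv_integrable[OF K u] by auto
  qed measurable
  have "(\<integral>x. conv K u x * \<psi> x \<partial>lborel) = (\<integral>x. (\<integral>y. K (x - y) * u y * \<psi> x \<partial>lborel) \<partial>lborel)"
    by (simp add: conv_def)
  also have "\<dots> = (\<integral>y. (\<integral>x. K (x - y) * u y * \<psi> x \<partial>lborel) \<partial>lborel)"
    by (rule lborel_pair.Fubini_integral[OF int, symmetric])
  also have "\<dots> = (\<integral>y. u y * (\<integral>x. K (x - y) * \<psi> x \<partial>lborel) \<partial>lborel)"
  proof -
    have "(\<integral>x. K (x - y) * u y * \<psi> x \<partial>lborel) = u y * (\<integral>x. K (x - y) * \<psi> x \<partial>lborel)" for y
      by (subst integral_mult_right_zero[symmetric]) (simp add: ac_simps)
    then show ?thesis by simp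
  qed
  finally show ?thesis .
qed

text \<open>Tested against \<open>\<phi>' + a \<phi>\<close>, the kernel gives a multiple of a point evaluation, because
  \<open>exp (a x) (\<phi>' + a \<phi>)\<close> is the derivative of \<open>exp (a x) \<phi>\<close>.\<close>

lemma exp_kernel_fundamental_solution:
  assumes a: "a \<noteq> 0" and t: "test_function \<phi>"
  shows "(\<integral>x. exp_kernel a (x - y) * (deriv \<phi> x + a * \<phi> x) \<partial>lborel) = sgn a * \<phi> y"
proof -
  obtain R1 where R1: "0 < R1" "\<And>x. R1 \<le> \<bar>x\<bar> \<Longrightarrow> \<phi> x = 0" using test_function_support[OF t] by blast
  obtain R2 where R2: "0 < R2" "\<And>x. R2 \<le> \<bar>x\<bar> \<Longrightarrow> deriv \<phi> x = 0"
    using test_function_support[OF test_function_deriv[OF t]] by blast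
  \<comment> \<open>beyond \<open>M\<close> both \<open>\<phi>\<close> and its derivative vanish, so the integral is over a bounded interval\<close>
  define M where "M = R1 + R2 + \<bar>y\<bar>"
  have M: "0 < M" "\<bar>y\<bar> \<le> M" "\<And>x. M \<le> \<bar>x\<bar> \<Longrightarrow> \<phi> x = 0 \<and> deriv \<phi> x = 0"
    using R1 R2 by (auto simp: M_def)
  define \<psi> where "\<psi> = (\<lambda>x. exp (a * (x - y)) * (deriv \<phi> x + a * \<phi> x))"
  have d: "((\<lambda>x. exp (a * (x - y)) * \<phi> x) has_real_derivative \<psi> x) (at x)" for x
    unfolding \<psi>_def using test_function_DERIV[OF t, of x]
    by (auto intro!: derivative_eq_intros simp: algebra_simps)
  have c: "isCont \<psi> x" for x
    unfolding \<psi>_def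
    by (intro continuous_intros test_function_continuous[OF t] test_function_continuous[OF test_function_deriv[OF t]])
  have [measurable]: "\<phi> \<in> borel_measurable borel" "deriv \<phi> \<in> borel_measurable borel"
    using test_function_continuous(2)[OF t] test_function_continuous(2)[OF test_function_deriv[OF t]] by auto
  have [measurable]: "\<psi> \<in> borel_measurable borel" unfolding \<psi>_def by measurable
  show ?thesis
  proof (cases "a < 0")
    case True
    have "(\<integral>x. exp_kernel a (x - y) * (deriv \<phi> x + a * \<phi> x) \<partial>lborel) = (\<integral>x. \<psi> x * indicator {y..M} x \<partial>lborel)"
    proof (rule integral_cong_AE)
      show "AE x in lborel. exp_kernel a (x - y) * (deriv \<phi> x + a * \<phi> x) = \<psi> x * indicator {y..M} x"
        using AE_lborel_singleton[of y]
      proof (rule eventually_mono)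
        fix x assume "x \<noteq> y"
        then show "exp_kernel a (x - y) * (deriv \<phi> x + a * \<phi> x) = \<psi> x * indicator {y..M} x"
          using True M(3)[of x] by (auto simp: exp_kernel_def \<psi>_def indicator_def mult_less_0_iff)
      qed
    qed measurable
    also have "\<dots> = exp (a * (M - y)) * \<phi> M - exp (a * (y - y)) * \<phi> y"
      using M(2) by (intro integral_FTC_Icc_real d c) auto
    finally show ?thesis using True M by simp
  next
    case False
    then have a: "0 < a" using a by simp
    have "(\<integral>x. exp_kernel a (x - y) * (deriv \<phi> x + a * \<phi> x) \<partial>lborel) = (\<integral>x. \<psi> x * indicator {-M..y} x \<partial>lborel)"
    proof (rule integral_cong_AE)
      show "AE x in lborel. exp_kernel a (x - y) * (deriv \<phi> x + a * \<phi> x) = \<psi> x * indicator {-M..y} x"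
        using AE_lborel_singleton[of y]
      proof (rule eventually_mono)
        fix x assume "x \<noteq> y"
        then show "exp_kernel a (x - y) * (deriv \<phi> x + a * \<phi> x) = \<psi> x * indicator {-M..y} x"
          using a M(3)[of x] by (auto simp: exp_kernel_def \<psi>_def indicator_def mult_less_0_iff)
      qed
    qed measurable
    also have "\<dots> = exp (a * (y - y)) * \<phi> y - exp (a * (- M - y)) * \<phi> (- M)"
      using M(2) by (intro integral_FTC_Icc_real d c) auto
    finally show ?thesis using a M by simp
  qed
qed

lemma weak_deriv_conv_exp_kernel:
  assumes a: "a \<noteq> 0" and u: "nonneg_bounded u"
  shows "weak_deriv 1 (conv (exp_kernel a) u) (\<lambda>x. a * conv (exp_kernel a) u x + (- sgn a) * u x)"
proof (rule weak_deriv_bounded_borelI)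
  note v = nonneg_bounded_imp_bounded_borel[OF conv_nonneg_bounded[OF exp_kernel_conv_kernel(1)[OF a] u]]
  show "bounded_borel (conv (exp_kernel a) u)" by (rule v)
  show "bounded_borel (\<lambda>x. a * conv (exp_kernel a) u x + (- sgn a) * u x)" by (intro bounded_borel_lincomb v nonneg_bounded_imp_bounded_borel[OF u])
  fix \<phi> assume t: "test_function \<phi>"
  note i = test_function_integrable[OF t]
  note i' = test_function_integrable[OF test_function_deriv[OF t]]
  have "(\<integral>x. conv (exp_kernel a) u x * deriv \<phi> x \<partial>lborel) + a * (\<integral>x. conv (exp_kernel a) u x * \<phi> x \<partial>lborel)
     = (\<integral>x. conv (exp_kernel a) u x * (deriv \<phi> x + a * \<phi> x) \<partial>lborel)"
    using bounded_borel_times_integrable[OF v i] bounded_borel_times_integrable[OF v i']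
    by (simp add: distrib_left mult.left_commute)
  also have "\<dots> = (\<integral>y. u y * (sgn a * \<phi> y) \<partial>lborel)"
    unfolding exp_kernel_fundamental_solution[OF a t, symmetric]
    using i i' by (intro conv_Fubini exp_kernel_conv_kernel(1)[OF a] u) auto
  also have "\<dots> = sgn a * (\<integral>y. u y * \<phi> y \<partial>lborel)" by (simp add: mult.left_commute)
  finally have "(\<integral>x. conv (exp_kernel a) u x * deriv \<phi> x \<partial>lborel)
      = - (a * (\<integral>x. conv (exp_kernel a) u x * \<phi> x \<partial>lborel) + (- sgn a) * (\<integral>y. u y * \<phi> y \<partial>lborel))"
    by simp
  also have "a * (\<integral>x. conv (exp_kernel a) u x * \<phi> x \<partial>lborel) + (- sgn a) * (\<integral>y. u y * \<phi> y \<partial>lborel)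
      = (\<integral>x. (a * conv (exp_kernel a) u x + (- sgn a) * u x) * \<phi> x \<partial>lborel)"
    using bounded_borel_times_integrable[OF v i] bounded_borel_times_integrable[OF nonneg_bounded_imp_bounded_borel[OF u] i]
    by (simp add: left_diff_distrib mult.assoc)
  finally show "(\<integral>x. conv (exp_kernel a) u x * (deriv ^^ 1) \<phi> x \<partial>lborel)
      = (- 1) ^ 1 * (\<integral>x. (a * conv (exp_kernel a) u x + (- sgn a) * u x) * \<phi> x \<partial>lborel)" by simp
qed

lemma nonneg_bounded_Lp:
  assumes u: "nonneg_bounded u" and f: "power_integral s u < top" shows "u \<in> Lp s"
proof -
  note [measurable] = nonneg_bounded_meas[OF u]
  have "integrable lborel (\<lambda>x. u x powr s)"
    using f by (intro integrableI_nonneg) (auto simp: power_integral_def)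
  then have "integrable lebesgue (\<lambda>x. \<bar>u x\<bar> powr s)"
    using nonneg_bounded_nonneg[OF u] by (subst integrable_completion) auto
  then show ?thesis unfolding Lp_def by (auto intro: measurable_completion)
qed

lemma Lp_lincomb:
  assumes s: "0 < s" and u: "u \<in> Lp s" and v: "v \<in> Lp s"
  shows "(\<lambda>x. \<alpha> * u x + \<beta> * v x) \<in> Lp s"
proof -
  have [measurable]: "u \<in> borel_measurable lebesgue" "v \<in> borel_measurable lebesgue"
    and i: "integrable lebesgue (\<lambda>x. \<bar>u x\<bar> powr s)" "integrable lebesgue (\<lambda>x. \<bar>v x\<bar> powr s)"
    using u v by (auto simp: Lp_def)
  have le: "\<bar>\<alpha> * u x + \<beta> * v x\<bar> powr s
      \<le> (2 * \<bar>\<alpha>\<bar>) powr s * \<bar>u x\<bar> powr s + (2 * \<bar>\<beta>\<bar>) powr s * \<bar>v x\<bar> powr s" for x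
  proof -
    have max1: "X + Y \<le> 2 * max X Y" and max2: "(2 * max X Y) powr s \<le> (2 * X) powr s + (2 * Y) powr s"
      for X Y :: real by (simp_all add: max_def)
    have "\<bar>\<alpha> * u x + \<beta> * v x\<bar> \<le> \<bar>\<alpha>\<bar> * \<bar>u x\<bar> + \<bar>\<beta>\<bar> * \<bar>v x\<bar>"
      unfolding abs_mult[symmetric] by (rule abs_triangle_ineq)
    then have "\<bar>\<alpha> * u x + \<beta> * v x\<bar> powr s \<le> (2 * max (\<bar>\<alpha>\<bar> * \<bar>u x\<bar>) (\<bar>\<beta>\<bar> * \<bar>v x\<bar>)) powr s"
      using s by (intro powr_mono2 order_trans[OF _ max1]) auto
    also have "\<dots> \<le> (2 * (\<bar>\<alpha>\<bar> * \<bar>u x\<bar>)) powr s + (2 * (\<bar>\<beta>\<bar> * \<bar>v x\<bar>)) powr s"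
      by (rule max2)
    finally show ?thesis by (simp add: powr_mult mult.assoc)
  qed
  have "integrable lebesgue (\<lambda>x. \<bar>\<alpha> * u x + \<beta> * v x\<bar> powr s)"
  proof (rule Bochner_Integration.integrable_bound)
    show "integrable lebesgue (\<lambda>x. (2 * \<bar>\<alpha>\<bar>) powr s * \<bar>u x\<bar> powr s + (2 * \<bar>\<beta>\<bar>) powr s * \<bar>v x\<bar> powr s)"
      by (intro Bochner_Integration.integrable_add integrable_mult_right i)
    show "AE x in lebesgue. norm (\<bar>\<alpha> * u x + \<beta> * v x\<bar> powr s)
        \<le> norm ((2 * \<bar>\<alpha>\<bar>) powr s * \<bar>u x\<bar> powr s + (2 * \<bar>\<beta>\<bar>) powr s * \<bar>v x\<bar> powr s)"
    proof (rule AE_I2)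
      fix x
      show "norm (\<bar>\<alpha> * u x + \<beta> * v x\<bar> powr s)
        \<le> norm ((2 * \<bar>\<alpha>\<bar>) powr s * \<bar>u x\<bar> powr s + (2 * \<bar>\<beta>\<bar>) powr s * \<bar>v x\<bar> powr s)"
        using order_trans[OF le[of x] abs_ge_self] by simp
    qed
  qed measurable
  then show ?thesis unfolding Lp_def by auto
qed

text \<open>The two first-order equations combine: with \<open>D\<close> for the derivative, \<open>(D - a) (D - b) g\<close> equals
  \<open>u\<close> up to the constant factor. Both \<open>a\<close> and \<open>b\<close> may have either sign, and they may coincide.\<close>

lemma second_order_solution:
  fixes a b c s :: real and u g :: "real \<Rightarrow> real"
  assumes ab: "a \<noteq> 0" "b \<noteq> 0" and u: "nonneg_bounded u" and s: "1 < s" "power_integral s u < top"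
    and g_eq: "\<And>x. g x = c * conv (conv (exp_kernel b) (exp_kernel a)) u x"
  shows "g \<in> sobolev 2 s"
    "\<exists>g1 g2. weak_deriv 1 g g1 \<and> weak_deriv 2 g g2 \<and>
       (\<forall>x. g2 x - (a + b) * g1 x + a * b * g x = c * (sgn a * sgn b) * u x)"
proof -
  define V where "V = conv (exp_kernel a) u"
  define G where "G = conv (exp_kernel b) V"
  note Ka = exp_kernel_conv_kernel(1)[OF ab(1)] and Kb = exp_kernel_conv_kernel(1)[OF ab(2)]
  have nV: "nonneg_bounded V" unfolding V_def by (rule conv_nonneg_bounded[OF Ka u])
  have nG: "nonneg_bounded G" unfolding G_def by (rule conv_nonneg_bounded[OF Kb nV])
  \<comment> \<open>a linear combination with a zero term, so that the lemmas on linear combinations apply\<close>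
  have g: "g = (\<lambda>x. c * G x + 0 * G x)"
    by (rule ext) (simp add: g_eq G_def V_def conv_assoc[OF Kb Ka u])
  have fV: "power_integral s V < top"
    unfolding V_def using s by (intro order.strict_trans1[OF power_integral_conv_le[OF Ka u s(1)]]) (auto simp: ennreal_mult_less_top)
  have fG: "power_integral s G < top"
    unfolding G_def using fV by (intro order.strict_trans1[OF power_integral_conv_le[OF Kb nV s(1)]]) (auto simp: ennreal_mult_less_top)
  have s0: "0 < s" using s by simp
  note L = nonneg_bounded_Lp[OF u s(2)] nonneg_bounded_Lp[OF nV fV] nonneg_bounded_Lp[OF nG fG]
  note bbs = nonneg_bounded_imp_bounded_borel[OF u] nonneg_bounded_imp_bounded_borel[OF nV] nonneg_bounded_imp_bounded_borel[OF nG]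
  define V1 where "V1 = (\<lambda>x. a * V x + (- sgn a) * u x)"
  define G1 where "G1 = (\<lambda>x. b * G x + (- sgn b) * V x)"
  define G2 where "G2 = (\<lambda>x. b * G1 x + (- sgn b) * V1 x)"
  have LV1: "V1 \<in> Lp s" and LG1: "G1 \<in> Lp s" and bV1: "bounded_borel V1" and bG1: "bounded_borel G1"
    unfolding V1_def G1_def by (intro Lp_lincomb bounded_borel_lincomb s0 L bbs)+
  have LG2: "G2 \<in> Lp s" and bG2: "bounded_borel G2"
    unfolding G2_def by (intro Lp_lincomb bounded_borel_lincomb s0 LV1 LG1 bV1 bG1)+
  have wV: "weak_deriv 1 V V1" unfolding V_def V1_def by (rule weak_deriv_conv_exp_kernel[OF ab(1) u])
  have wG: "weak_deriv 1 G G1" unfolding G_def G1_def by (rule weak_deriv_conv_exp_kernel[OF ab(2) nV])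
  have "weak_deriv 1 G1 G2"
    unfolding G2_def by (subst G1_def) (rule weak_deriv_lincomb[OF wG wV bbs(3) bG1 bbs(2) bV1])
  then have wG2: "weak_deriv 2 G G2" by (rule weak_deriv_trans[OF wG])
  define g1 where "g1 = (\<lambda>x. c * G1 x + 0 * G1 x)"
  define g2 where "g2 = (\<lambda>x. c * G2 x + 0 * G2 x)"
  have w1: "weak_deriv 1 g g1" unfolding g g1_def by (intro weak_deriv_lincomb wG bbs bG1)
  have w2: "weak_deriv 2 g g2" unfolding g g2_def by (intro weak_deriv_lincomb wG2 bbs bG2)
  have Lg: "g \<in> Lp s" "g1 \<in> Lp s" "g2 \<in> Lp s"
    unfolding g g1_def g2_def by (intro Lp_lincomb s0 L LG1 LG2)+
  have "bounded_borel g" unfolding g by (intro bounded_borel_lincomb bbs)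
  then have w0: "weak_deriv 0 g g" by (intro weak_deriv_bounded_borelI) auto
  have "\<exists>v\<in>Lp s. weak_deriv j g v" if "j \<le> 2" for j
  proof -
    have "j = 0 \<or> j = 1 \<or> j = 2" using that by linarith
    then show ?thesis using Lg w0 w1 w2 by blast
  qed
  then show "g \<in> sobolev 2 s" using Lg by (simp add: sobolev_def)
  have "g2 x - (a + b) * g1 x + a * b * g x = c * (sgn a * sgn b) * u x" for x
    unfolding g g1_def g2_def G2_def G1_def V1_def by (simp add: algebra_simps)
  then show "\<exists>g1 g2. weak_deriv 1 g g1 \<and> weak_deriv 2 g g2 \<and>
       (\<forall>x. g2 x - (a + b) * g1 x + a * b * g x = c * (sgn a * sgn b) * u x)"
    using w1 w2 by blast
qed

section \<open>Limits of convolutions\<close>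

text \<open>Pointwise convergence on the whole line suffices for dominated convergence, so the
  subsequence is chosen on the rationals and extended by equicontinuity.\<close>

lemma equicontinuous_subsequence:
  fixes g :: "nat \<Rightarrow> real \<Rightarrow> real"
  assumes bd: "\<And>n x. \<bar>g n x\<bar> \<le> M"
    and eq: "\<And>e. 0 < e \<Longrightarrow> \<exists>d>0. \<forall>n x y. \<bar>x - y\<bar> < d \<longrightarrow> \<bar>g n x - g n y\<bar> \<le> e"
  obtains k l where "strict_mono (k :: nat \<Rightarrow> nat)" "\<And>x. (\<lambda>n. g (k n) x) \<longlonglongrightarrow> l x"
proof -
  obtain k where k: "strict_mono (k :: nat \<Rightarrow> nat)"
    and lim: "\<And>x. x \<in> \<rat> \<Longrightarrow> \<exists>l. (\<lambda>n. g (k n) x) \<longlonglongrightarrow> l"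
    using function_convergent_subsequence[of "\<rat> :: real set" g M] bd countable_rat by auto
  have "Cauchy (\<lambda>n. g (k n) x)" for x
  proof (rule metric_CauchyI)
    fix e :: real assume e: "0 < e"
    obtain d where d: "0 < d" "\<And>n x y. \<bar>x - y\<bar> < d \<Longrightarrow> \<bar>g n x - g n y\<bar> \<le> e / 4"
      using eq[of "e / 4"] e by auto
    obtain z where z: "z \<in> \<rat>" "x < z" "z < x + d"
      using Rats_dense_in_real[of x "x + d"] d by auto
    have "Cauchy (\<lambda>n. g (k n) z)"
      using lim[OF z(1)] convergent_Cauchy convergent_def by blast
    moreover have "0 < e / 4" using e by simp
    ultimately have "\<exists>N. \<forall>m\<ge>N. \<forall>n\<ge>N. dist (g (k m) z) (g (k n) z) < e / 4" by (rule metric_CauchyD)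
    then obtain N where N: "\<And>m n. N \<le> m \<Longrightarrow> N \<le> n \<Longrightarrow> dist (g (k m) z) (g (k n) z) < e / 4"
      by blast
    have "dist (g (k m) x) (g (k n) x) < e" if "N \<le> m" "N \<le> n" for m n
      using N[OF that] d(2)[of x z "k m"] d(2)[of x z "k n"] z e unfolding dist_real_def by linarith
    then show "\<exists>N. \<forall>m\<ge>N. \<forall>n\<ge>N. dist (g (k m) x) (g (k n) x) < e" by blast
  qed
  then have "convergent (\<lambda>n. g (k n) x)" for x by (rule Cauchy_convergent)
  then have "\<And>x. \<exists>l. (\<lambda>n. g (k n) x) \<longlonglongrightarrow> l" by (simp add: convergent_def)
  then obtain l where "\<And>x. (\<lambda>n. g (k n) x) \<longlonglongrightarrow> l x" by metis
  then show ?thesis using that k by blast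
qed

lemma conv_tendsto:
  assumes K: "conv_kernel K" and v: "\<And>n. nonneg_bounded (v n)" and B: "\<And>n x. v n x \<le> B"
    and lim: "\<And>x. (\<lambda>n. v n x) \<longlonglongrightarrow> w x" and w: "nonneg_bounded w"
  shows "(\<lambda>n. conv K (v n) x) \<longlonglongrightarrow> conv K w x"
  unfolding conv_def
proof (rule integral_dominated_convergence[where w = "\<lambda>y. K (x - y) * B"])
  note [measurable] = nonneg_bounded_meas[OF v] nonneg_bounded_meas[OF w] conv_kernelD(3)[OF K]
  show "(\<lambda>y. K (x - y) * w y) \<in> borel_measurable lborel"
    "\<And>n. (\<lambda>y. K (x - y) * v n y) \<in> borel_measurable lborel" by measurable
  show "integrable lborel (\<lambda>y. K (x - y) * B)" using conv_kernel_shift(1)[OF K] by simp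
  show "AE y in lborel. (\<lambda>n. K (x - y) * v n y) \<longlonglongrightarrow> K (x - y) * w y"
    using lim by (auto intro!: tendsto_intros)
  show "AE y in lborel. norm (K (x - y) * v n y) \<le> K (x - y) * B" for n
    using B nonneg_bounded_nonneg[OF v] conv_kernelD(4)[OF K] by (auto simp: abs_mult intro!: mult_left_mono)
qed

lemma nonneg_bounded_limit:
  assumes v: "\<And>n. nonneg_bounded (v n)" and B: "\<And>n x. v n x \<le> B" and lim: "\<And>x. (\<lambda>n. v n x) \<longlonglongrightarrow> w x"
  shows "nonneg_bounded w" "\<And>x. w x \<le> B"
proof -
  show *: "w x \<le> B" for x using lim[of x] B by (intro LIMSEQ_le_const2) auto
  show "nonneg_bounded w"
  proof (rule nonneg_boundedI[OF _ _ *])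
    show "w \<in> borel_measurable borel"
      by (rule borel_measurable_LIMSEQ_real[OF lim]) (use nonneg_bounded_meas[OF v] in auto)
    show "0 \<le> w x" for x using lim[of x] nonneg_bounded_nonneg[OF v] by (intro LIMSEQ_le_const) auto
  qed
qed

lemma power_integral_limit:
  assumes v: "\<And>n. nonneg_bounded (v n)" and lim: "\<And>x. (\<lambda>n. v n x) \<longlonglongrightarrow> w x"
    and s: "0 < s" and c: "\<And>n. power_integral s (v n) \<le> c"
  shows "power_integral s w \<le> c"
proof -
  note [measurable] = nonneg_bounded_meas[OF v]
  have w0: "0 \<le> w x" for x using lim[of x] nonneg_bounded_nonneg[OF v] by (intro LIMSEQ_le_const) auto
  have "liminf (\<lambda>n. ennreal (v n x powr s)) = ennreal (w x powr s)" for x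
  proof (rule lim_imp_Liminf)
    have "(\<lambda>n. v n x powr s) \<longlonglongrightarrow> w x powr s"
      using lim[of x] s nonneg_bounded_nonneg[OF v] by (intro tendsto_powr2) auto
    then show "(\<lambda>n. ennreal (v n x powr s)) \<longlonglongrightarrow> ennreal (w x powr s)" by (rule tendsto_ennrealI)
  qed simp
  then have "power_integral s w = (\<integral>\<^sup>+x. liminf (\<lambda>n. ennreal (v n x powr s)) \<partial>lborel)"
    unfolding power_integral_def by simp
  also have "\<dots> \<le> liminf (\<lambda>n. power_integral s (v n))"
    unfolding power_integral_def by (rule nn_integral_liminf) measurable
  also have "\<dots> \<le> liminf (\<lambda>n. c)" using c by (intro Liminf_mono) auto
  also have "\<dots> = c" by (simp add: Liminf_const)
  finally show ?thesis .
qed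

lemma powr_truncate:
  fixes u T r :: real
  assumes "0 \<le> u" "0 < T" "1 < r"
  shows "u \<le> T + T powr (1 - r) * u powr r"
proof (cases "u \<le> T")
  case True then show ?thesis by (simp add: add_increasing2)
next
  case False
  then have "u = u powr (1 - r) * u powr r" using assms by (simp add: powr_add[symmetric])
  also have "\<dots> \<le> T powr (1 - r) * u powr r"
    using False assms by (intro mult_right_mono powr_mono2') auto
  finally show ?thesis using assms by simp
qed

lemma power_integral_le_integrable:
  assumes u: "nonneg_bounded u" and c: "power_integral s u \<le> ennreal c" "0 \<le> c"
  shows "integrable lborel (\<lambda>x. u x powr s)" "(\<integral>x. u x powr s \<partial>lborel) \<le> c"
proof -
  note [measurable] = nonneg_bounded_meas[OF u]
  show 1: "integrable lborel (\<lambda>x. u x powr s)"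
    using c(1) le_less_trans[OF c(1) ennreal_less_top] by (intro integrableI_nonneg) (auto simp: power_integral_def)
  have 2: "power_integral s u = ennreal (\<integral>x. u x powr s \<partial>lborel)"
    unfolding power_integral_def by (rule nn_integral_eq_integral[OF 1]) auto
  show "(\<integral>x. u x powr s \<partial>lborel) \<le> c"
    using c unfolding 2 by (simp add: ennreal_le_iff)
qed

section \<open>A convolution system on the line\<close>

text \<open>The system of integral equations \<open>g = H * f\<^bsup>p-1\<^esup>\<close>, \<open>f = H' * g\<^bsup>q-1\<^esup>\<close> with \<open>H'\<close> the reflection of
  \<open>H\<close>, for a kernel whose translations are continuous in \<open>L\<^sup>1\<close>.\<close>

locale convolution_system =
  fixes H :: "real \<Rightarrow> real" and p q :: real
  assumes kernel_H: "conv_kernel H" and mass_pos: "0 < mass H"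
    and modulus: "\<And>e. 0 < e \<Longrightarrow> \<exists>d>0. \<forall>h. \<bar>h\<bar> < d \<longrightarrow> (\<integral>x. \<bar>H (h + x) - H x\<bar> \<partial>lborel) \<le> e"
    and p: "1 < p" and q: "1 < q" and pq: "1 / p + 1 / q < 1"
begin

text \<open>The conjugate exponent of \<open>p\<close>. The hypothesis on the exponents says that \<open>r < q\<close>.\<close>

definition r :: real where "r = p / (p - 1)"

text \<open>The admissible densities: the nonnegative part of the unit ball of \<open>L\<^sup>r\<close>, restricted to bounded
  functions.\<close>

definition admissible :: "(real \<Rightarrow> real) set" where "admissible = {u. nonneg_bounded u \<and> power_integral r u \<le> 1}"

text \<open>The supremum of \<open>\<integral>(H * u)\<^sup>q\<close>, that is, the \<open>q\<close>-th power of the norm of convolution with \<open>H\<close>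
  from \<open>L\<^sup>r\<close> to \<open>L\<^sup>q\<close>.\<close>

definition S :: real where "S = enn2real (SUP u\<in>admissible. power_integral q (conv H u))"

text \<open>The reflected kernel.\<close>

definition H' :: "real \<Rightarrow> real" where "H' = (\<lambda>t. H (- t))"

text \<open>An upper bound for \<open>H\<close>.\<close>

definition C :: real where "C = (SOME c. 0 \<le> c \<and> (\<forall>x. H x \<le> c))"

text \<open>An upper bound for \<open>H * u\<close> for all admissible \<open>u\<close>.\<close>

definition G0 :: real where "G0 = mass H + C"

lemma C: "0 \<le> C" "H x \<le> C"
  using someI_ex[of "\<lambda>c. 0 \<le> c \<and> (\<forall>x. H x \<le> c)"] nonneg_bounded_bound[OF conv_kernelD(1)[OF kernel_H]]
  unfolding C_def by auto

lemma kernel_H': "conv_kernel H'" "mass H' = mass H"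
  using conv_kernel_reflect[OF kernel_H] by (auto simp: H'_def)

lemma r: "1 < r" "r < q" "(p - 1) * (r - 1) = 1" "(p - 1) * r = p" "1 - 1 / r = 1 / p" "1/r = 1 - 1/p"
proof -
  show "1 < r" "(p - 1) * (r - 1) = 1" "(p - 1) * r = p"  "1 - 1 / r = 1 / p" "1/r = 1 - 1/p"
    using p by (auto simp: r_def field_simps)
  show "r < q" using p q pq by (simp add: r_def field_simps)
qed

lemma admissibleD:
  assumes "u \<in> admissible"
  shows "nonneg_bounded u" "power_integral r u \<le> 1" "integrable lborel (\<lambda>x. u x powr r)" "(\<integral>x. u x powr r \<partial>lborel) \<le> 1"
proof -
  show 1: "nonneg_bounded u" "power_integral r u \<le> 1" using assms by (auto simp: admissible_def)
  show "integrable lborel (\<lambda>x. u x powr r)" "(\<integral>x. u x powr r \<partial>lborel) \<le> 1"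
    using power_integral_le_integrable[OF 1(1), of r 1] 1 by auto
qed

text \<open>The truncation level \<open>T\<close> is free. Taking \<open>T = 1\<close> gives a uniform bound for \<open>H * u\<close>; taking \<open>T\<close> large,
  and \<open>J\<close> a difference of two translates of \<open>H\<close>, gives equicontinuity.\<close>

lemma integral_weighted_le:
  assumes J: "J \<in> borel_measurable borel" "\<And>y. \<bar>J y\<bar> \<le> C" "integrable lborel J"
    and T: "0 < T" and u: "u \<in> admissible"
  shows "integrable lborel (\<lambda>y. \<bar>J y\<bar> * u y)"
    "(\<integral>y. \<bar>J y\<bar> * u y \<partial>lborel) \<le> T * (\<integral>y. \<bar>J y\<bar> \<partial>lborel) + C * T powr (1 - r)"
proof -
  note [measurable] = J(1) nonneg_bounded_meas[OF admissibleD(1)[OF u]]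
  note u0 = nonneg_bounded_nonneg[OF admissibleD(1)[OF u]]
  have le: "\<bar>J y\<bar> * u y \<le> T * \<bar>J y\<bar> + C * T powr (1 - r) * (u y powr r)" for y
  proof -
    have "\<bar>J y\<bar> * u y \<le> \<bar>J y\<bar> * (T + T powr (1 - r) * u y powr r)"
      using powr_truncate[OF u0 T r(1)] by (intro mult_left_mono) auto
    also have "\<dots> = T * \<bar>J y\<bar> + \<bar>J y\<bar> * (T powr (1 - r) * u y powr r)" by (simp add: algebra_simps)
    also have "\<dots> \<le> T * \<bar>J y\<bar> + C * (T powr (1 - r) * u y powr r)"
      using J(2) by (intro add_left_mono mult_right_mono) auto
    finally show ?thesis by (simp add: mult.assoc)
  qed
  have int: "integrable lborel (\<lambda>y. T * \<bar>J y\<bar> + C * T powr (1 - r) * (u y powr r))"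
    using J(3) admissibleD(3)[OF u] by auto
  show i: "integrable lborel (\<lambda>y. \<bar>J y\<bar> * u y)"
    by (rule Bochner_Integration.integrable_bound[OF int])
      (use le u0 in \<open>auto simp: abs_mult intro: order_trans[OF le abs_ge_self]\<close>)
  have "(\<integral>y. \<bar>J y\<bar> * u y \<partial>lborel) \<le> (\<integral>y. T * \<bar>J y\<bar> + C * T powr (1 - r) * (u y powr r) \<partial>lborel)"
    by (rule integral_mono[OF i int le])
  also have "\<dots> = T * (\<integral>y. \<bar>J y\<bar> \<partial>lborel) + C * T powr (1 - r) * (\<integral>y. u y powr r \<partial>lborel)"
    using J(3) admissibleD(3)[OF u] by simp
  also have "\<dots> \<le> T * (\<integral>y. \<bar>J y\<bar> \<partial>lborel) + C * T powr (1 - r) * 1"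
    using admissibleD(4)[OF u] C(1) by (intro add_left_mono mult_left_mono) auto
  finally show "(\<integral>y. \<bar>J y\<bar> * u y \<partial>lborel) \<le> T * (\<integral>y. \<bar>J y\<bar> \<partial>lborel) + C * T powr (1 - r)" by simp
qed

lemma admissible_bound:
  assumes u: "u \<in> admissible" shows "conv H u x \<le> G0"
proof -
  note [measurable] = conv_kernelD(3)[OF kernel_H]
  show ?thesis
  using integral_weighted_le(2)[of "\<lambda>y. H (x - y)" 1 u] conv_kernelD(4)[OF kernel_H] C conv_kernel_shift(1,2)[OF kernel_H] u
  by (auto simp: conv_def G0_def)
qed

lemma admissible_equicontinuous:
  assumes e: "0 < e"
  shows "\<exists>d>0. \<forall>u\<in>admissible. \<forall>x y. \<bar>x - y\<bar> < d \<longrightarrow> \<bar>conv H u x - conv H u y\<bar> \<le> e"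
proof -
  note [measurable] = conv_kernelD(3)[OF kernel_H]
  \<comment> \<open>large enough for \<open>C * T powr (1 - r)\<close> to be at most \<open>e / 2\<close>\<close>
  define T where "T = (2 * C / e + 1) powr (1 / (r - 1))"
  have pos: "0 < 2 * C / e + 1" using C(1) e by (simp add: add_nonneg_pos)
  have T: "0 < T" using pos by (simp add: T_def)
  have "1 / (r - 1) * (1 - r) = - 1" using r(1) by (simp add: field_simps)
  then have "T powr (1 - r) = (2 * C / e + 1) powr (- 1)"
    unfolding T_def powr_powr by simp
  also have "\<dots> = 1 / (2 * C / e + 1)" using pos by (simp add: powr_minus_divide)
  finally have "C * T powr (1 - r) = C / (2 * C / e + 1)" by simp
  also have "\<dots> \<le> e / 2" using pos C(1) e by (simp add: field_simps)
  finally have T2: "C * T powr (1 - r) \<le> e / 2" .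
  obtain d where d: "0 < d" "\<And>h. \<bar>h\<bar> < d \<Longrightarrow> (\<integral>x. \<bar>H (h + x) - H x\<bar> \<partial>lborel) \<le> e / (2 * T)"
    using modulus[of "e / (2 * T)"] e T by auto
  have "\<bar>conv H u x - conv H u y\<bar> \<le> e" if u: "u \<in> admissible" and xy: "\<bar>x - y\<bar> < d" for u x y
  proof -
    define J where "J = (\<lambda>z. H (x - z) - H (y - z))"
    note [measurable] = nonneg_bounded_meas[OF admissibleD(1)[OF u]]
    have J: "J \<in> borel_measurable borel" "\<And>z. \<bar>J z\<bar> \<le> C" "integrable lborel J"
    proof -
      show "\<bar>J z\<bar> \<le> C" for z
        using C(2)[of "x - z"] C(2)[of "y - z"] conv_kernelD(4)[OF kernel_H, of "x - z"] conv_kernelD(4)[OF kernel_H, of "y - z"]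
        unfolding J_def by linarith
    qed (use conv_kernel_shift(1)[OF kernel_H] in \<open>auto simp: J_def\<close>)
    have "conv H u x - conv H u y = (\<integral>z. J z * u z \<partial>lborel)"
      unfolding conv_def J_def left_diff_distrib
      by (rule Bochner_Integration.integral_diff[symmetric]) (rule conv_integrable[OF kernel_H admissibleD(1)[OF u]])+
    also have "\<bar>\<dots>\<bar> \<le> (\<integral>z. \<bar>J z * u z\<bar> \<partial>lborel)" by (rule integral_abs_bound)
    also have "\<dots> = (\<integral>z. \<bar>J z\<bar> * u z \<partial>lborel)"
      using nonneg_bounded_nonneg[OF admissibleD(1)[OF u]] by (simp add: abs_mult)
    also have "\<dots> \<le> T * (\<integral>z. \<bar>J z\<bar> \<partial>lborel) + C * T powr (1 - r)"
      by (rule integral_weighted_le(2)[OF J T u])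
    also have "(\<integral>z. \<bar>J z\<bar> \<partial>lborel) = (\<integral>z. \<bar>H ((x - y) + z) - H z\<bar> \<partial>lborel)"
      using lborel_integral_real_affine[of "-1" "\<lambda>z. \<bar>H ((x - y) + z) - H z\<bar>" y]
      by (simp add: J_def algebra_simps)
    also have "T * \<dots> \<le> T * (e / (2 * T))"
      using d(2)[OF xy] T by (intro mult_left_mono) auto
    finally show ?thesis using T T2 by simp
  qed
  then show ?thesis using d(1) by blast
qed

text \<open>A small supremum of \<open>H * u\<close> forces a small \<open>\<integral>(H * u)\<^sup>q\<close>, because \<open>r < q\<close>: this is what excludes the
  vanishing of a maximizing sequence.\<close>

lemma power_integral_admissible_le:
  assumes u: "u \<in> admissible" and c: "\<And>x. conv H u x \<le> c"
  shows "power_integral q (conv H u) \<le> ennreal (c powr (q - r) * mass H powr r)"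
proof -
  note n = conv_nonneg_bounded[OF kernel_H admissibleD(1)[OF u]]
  have "power_integral q (conv H u) \<le> ennreal (c powr (q - r)) * power_integral r (conv H u)"
    by (rule power_integral_interpolate[OF n c]) (use r in auto)
  also have "\<dots> \<le> ennreal (c powr (q - r)) * (ennreal (mass H powr r) * 1)"
  proof (intro mult_left_mono)
    show "power_integral r (conv H u) \<le> ennreal (mass H powr r) * 1"
      by (rule order_trans[OF power_integral_conv_le[OF kernel_H admissibleD(1)[OF u] r(1)]]) (intro mult_left_mono admissibleD(2)[OF u] zero_le)
  qed simp
  finally show ?thesis by (simp add: ennreal_mult)
qed

lemma sup_eq: "(SUP u\<in>admissible. power_integral q (conv H u)) = ennreal S"
proof -
  have "(SUP u\<in>admissible. power_integral q (conv H u)) \<le> ennreal (G0 powr (q - r) * mass H powr r)"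
    by (intro SUP_least power_integral_admissible_le admissible_bound)
  then have "(SUP u\<in>admissible. power_integral q (conv H u)) < top" using ennreal_less_top order.strict_trans1 by blast
  then show ?thesis by (simp add: S_def)
qed

lemma S_upper: "u \<in> admissible \<Longrightarrow> power_integral q (conv H u) \<le> ennreal S"
  unfolding sup_eq[symmetric] by (rule SUP_upper)

lemma S_pos: "0 < S"
proof (rule ccontr)
  assume neg: "\<not> 0 < S"
  define u :: "real \<Rightarrow> real" where "u = indicator {0..1}"
  have [measurable]: "u \<in> borel_measurable borel" by (simp add: u_def)
  have nu: "nonneg_bounded u" by (intro nonneg_boundedI[of _ 1]) (auto simp: u_def indicator_def)
  have "u x powr r = u x" for x by (simp add: u_def indicator_def)
  then have pu: "power_integral r u = (\<integral>\<^sup>+x. ennreal (u x) \<partial>lborel)" by (simp add: power_integral_def)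
  also have one: "\<dots> = 1" by (simp add: u_def ennreal_indicator)
  finally have uU: "u \<in> admissible" using nu by (simp add: admissible_def)
  have nc: "nonneg_bounded (conv H u)" by (rule conv_nonneg_bounded[OF kernel_H nu])
  note [measurable] = nonneg_bounded_meas[OF nc]
  have "power_integral q (conv H u) = 0" using S_upper[OF uU] neg by (simp add: ennreal_neg)
  then have "AE x in lborel. conv H u x = 0"
    unfolding power_integral_def using q by (subst (asm) nn_integral_0_iff_AE) auto
  then have "(\<integral>\<^sup>+x. ennreal (conv H u x) \<partial>lborel) = 0"
    by (subst nn_integral_0_iff_AE) auto
  then show False using conv_total[OF kernel_H nu] one mass_pos by simp
qed

text \<open>The function dual to \<open>H * u\<close>; it equals the second component of the system when \<open>H * u\<close> is the
  first.\<close>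

definition F :: "(real \<Rightarrow> real) \<Rightarrow> real \<Rightarrow> real" where
  "F u = conv H' (\<lambda>y. conv H u y powr (q - 1))"

lemma g_nonneg_bounded: "u \<in> admissible \<Longrightarrow> nonneg_bounded (conv H u)" "u \<in> admissible \<Longrightarrow> nonneg_bounded (\<lambda>y. conv H u y powr (q - 1))"
  using conv_nonneg_bounded[OF kernel_H admissibleD(1)] nonneg_bounded_powr q by auto

lemma F_nonneg_bounded: "u \<in> admissible \<Longrightarrow> nonneg_bounded (F u)"
  unfolding F_def by (intro conv_nonneg_bounded kernel_H' g_nonneg_bounded)

lemma F_bound: "u \<in> admissible \<Longrightarrow> F u x \<le> mass H * G0 powr (q - 1)"
  unfolding F_def kernel_H'(2)[symmetric]
  by (intro conv_bound kernel_H' g_nonneg_bounded powr_mono2 admissible_bound) (use q conv_nonneg[OF kernel_H admissibleD(1)] in auto)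

text \<open>Finiteness is needed before the normalization in the next lemma. It holds because the exponent
  conjugate to \<open>q\<close> is at most \<open>p\<close>.\<close>

lemma power_integral_F_finite:
  assumes u: "u \<in> admissible" shows "power_integral p (F u) < top"
proof -
  define s where "s = q / (q - 1)"
  have s: "1 < s" "s \<le> p" "(q - 1) * s = q" using p q pq by (auto simp: s_def field_simps)
  have "power_integral s (\<lambda>y. conv H u y powr (q - 1)) = power_integral q (conv H u)"
    by (simp add: power_integral_def powr_powr s)
  also have "\<dots> < top" using S_upper[OF u] ennreal_less_top order.strict_trans1 by blast
  finally have "ennreal (mass H' powr s) * power_integral s (\<lambda>y. conv H u y powr (q - 1)) < top"
    by (simp add: ennreal_mult_less_top)
  then have "power_integral s (F u) < top"
    using power_integral_conv_le[OF kernel_H'(1) g_nonneg_bounded(2)[OF u] s(1)] unfolding F_def by (rule order.strict_trans1[rotated])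
  then have "ennreal ((mass H * G0 powr (q - 1)) powr (p - s)) * power_integral s (F u) < top"
    by (simp add: ennreal_mult_less_top)
  then show ?thesis
    using power_integral_interpolate[OF F_nonneg_bounded[OF u] F_bound[OF u] s(2)] by (rule order.strict_trans1[rotated])
qed

text \<open>Duality: \<open>F u\<close> is tested against the admissible function \<open>v\<close> proportional to its own power
  \<open>(F u)\<^bsup>p-1\<^esup>\<close>, and the integral is moved to \<open>H * v\<close>, whose \<open>q\<close>-th power has integral at most \<open>S\<close>.\<close>

lemma power_integral_F_le:
  assumes u: "u \<in> admissible" shows "power_integral p (F u) \<le> ennreal (S powr p)"
proof -
  define \<Phi> where "\<Phi> = enn2real (power_integral p (F u))"
  have \<Phi>: "power_integral p (F u) = ennreal \<Phi>" using power_integral_F_finite[OF u] by (simp add: \<Phi>_def)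
  have \<Phi>0: "0 \<le> \<Phi>" by (simp add: \<Phi>_def)
  show ?thesis
  proof (cases "\<Phi> = 0")
    case True then show ?thesis using \<Phi> by simp
  next
    case False
    then have \<Phi>p: "0 < \<Phi>" using \<Phi>0 by simp
    define v where "v = (\<lambda>y. \<Phi> powr (- 1 / r) * F u y powr (p - 1))"
    have nv: "nonneg_bounded v" unfolding v_def using nonneg_bounded_cmult nonneg_bounded_powr[OF F_nonneg_bounded[OF u]] p by auto
    note [measurable] = nonneg_bounded_meas[OF nv] nonneg_bounded_meas[OF F_nonneg_bounded[OF u]] nonneg_bounded_meas[OF g_nonneg_bounded(1)[OF u]]
    have "- 1 / r * r = - 1" using r(1) by simp
    then have "v x powr r = \<Phi> powr (- 1) * F u x powr p" for x
      unfolding v_def by (simp only: powr_mult powr_powr r(4))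
    then have "power_integral r v = ennreal (\<Phi> powr (- 1)) * power_integral p (F u)"
      unfolding power_integral_def by (subst nn_integral_cmult[symmetric]) (auto simp: ennreal_mult[symmetric])
    also have "\<dots> = ennreal 1" using \<Phi>p unfolding \<Phi> by (simp add: ennreal_mult[symmetric] powr_minus_divide)
    finally have vU: "v \<in> admissible" using nv by (simp add: admissible_def)
    note [measurable] = nonneg_bounded_meas[OF g_nonneg_bounded(1)[OF vU]]
    have "ennreal (\<Phi> powr (- 1 / r) * \<Phi>) = ennreal (\<Phi> powr (- 1 / r)) * power_integral p (F u)"
      using \<Phi> \<Phi>0 by (simp add: ennreal_mult)
    also have "\<dots> = (\<integral>\<^sup>+x. ennreal (v x * F u x) \<partial>lborel)"
    proof -
      have "v x * F u x = \<Phi> powr (- 1 / r) * F u x powr p" for x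
        unfolding v_def using nonneg_bounded_nonneg[OF F_nonneg_bounded[OF u], of x]
        by (cases "F u x = 0") (auto simp: powr_diff)
      then show ?thesis unfolding power_integral_def by (simp add: ennreal_mult nn_integral_cmult)
    qed
    also have "\<dots> = (\<integral>\<^sup>+x. ennreal (conv H v x * conv H u x powr (q - 1)) \<partial>lborel)"
      unfolding F_def H'_def by (rule conv_dual[OF kernel_H nv g_nonneg_bounded(2)[OF u], symmetric])
    also have "\<dots> \<le> (\<integral>\<^sup>+x. ennreal (1 / q) * ennreal (conv H v x powr q)
        + ennreal (1 - 1 / q) * ennreal (conv H u x powr q) \<partial>lborel)"
      using young_powr[OF q conv_nonneg[OF kernel_H nv] conv_nonneg[OF kernel_H admissibleD(1)[OF u]]] q
      by (intro nn_integral_mono) (simp add: ennreal_mult[symmetric] ennreal_plus[symmetric] del: ennreal_plus)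
    also have "\<dots> = ennreal (1 / q) * power_integral q (conv H v) + ennreal (1 - 1 / q) * power_integral q (conv H u)"
      unfolding power_integral_def by (subst nn_integral_add) (auto simp: nn_integral_cmult)
    also have "\<dots> \<le> ennreal (1 / q) * ennreal S + ennreal (1 - 1 / q) * ennreal S"
      using S_upper[OF u] S_upper[OF vU] by (intro add_mono mult_left_mono) auto
    also have "\<dots> = ennreal S"
    proof -
      have "ennreal (1 / q) + ennreal (1 - 1 / q) = 1"
        using q by (subst ennreal_plus[symmetric]) auto
      then show ?thesis by (simp add: distrib_right[symmetric])
    qed
    finally have "\<Phi> powr (- 1 / r) * \<Phi> \<le> S" using S_pos by (simp add: ennreal_le_iff)
    moreover have "\<Phi> powr (- 1 / r) * \<Phi> = \<Phi> powr (1 / p)"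
      using \<Phi>p r(6) by (simp add: powr_minus powr_diff)
    ultimately have "\<Phi> powr (1 / p) \<le> S" by simp
    then have "(\<Phi> powr (1 / p)) powr p \<le> S powr p" using p by (intro powr_mono2) auto
    then show ?thesis using \<Phi> \<Phi>p p by (simp add: powr_powr ennreal_le_iff)
  qed
qed

text \<open>The candidate to which a near maximizer \<open>u\<close> must be close; \<open>u = W u\<close> is the Euler-Lagrange
  equation of the maximization problem.\<close>

definition W :: "(real \<Rightarrow> real) \<Rightarrow> real \<Rightarrow> real" where
  "W u = (\<lambda>y. (F u y / S) powr (p - 1))"

lemma W_nonneg_bounded: "u \<in> admissible \<Longrightarrow> nonneg_bounded (W u)"
  using nonneg_bounded_powr[OF nonneg_bounded_cmult[OF F_nonneg_bounded], of u "1 / S" "p - 1"] S_pos p by (simp add: W_def)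

lemma W_bound: "u \<in> admissible \<Longrightarrow> W u x \<le> (mass H * G0 powr (q - 1) / S) powr (p - 1)"
  unfolding W_def using F_bound nonneg_bounded_nonneg[OF F_nonneg_bounded] S_pos p
  by (intro powr_mono2) (auto intro: divide_right_mono)

text \<open>The pointwise deficit in Young's inequality between \<open>u\<close> and \<open>W u\<close>.\<close>

definition deficit :: "(real \<Rightarrow> real) \<Rightarrow> real \<Rightarrow> real" where
  "deficit u y = u y powr r / r + (1 - 1 / r) * W u y powr r - u y * W u y powr (r - 1)"

text \<open>The total deficit is small for a near maximizer, since \<open>\<integral>u (F u)\<close> equals \<open>\<integral>(H * u)\<^sup>q\<close> while neither
  factor exceeds its norm bound.\<close>

lemma deficit_integral:
  assumes u: "u \<in> admissible" and s: "0 \<le> s" "ennreal s \<le> power_integral q (conv H u)"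
  shows "integrable lborel (deficit u)" "(\<integral>y. deficit u y \<partial>lborel) \<le> 1 - s / S"
proof -
  note nF = F_nonneg_bounded[OF u]
  note [measurable] = nonneg_bounded_meas[OF nF] nonneg_bounded_meas[OF admissibleD(1)[OF u]]
  have W1: "W u y powr (r - 1) = F u y / S" for y
    unfolding W_def powr_powr r using nonneg_bounded_nonneg[OF nF] S_pos by simp
  have W2: "W u y powr r = F u y powr p / S powr p" for y
    unfolding W_def powr_powr r using nonneg_bounded_nonneg[OF nF] S_pos by (simp add: powr_divide)
  have d: "deficit u = (\<lambda>y. u y powr r / r + (1 / p) * (F u y powr p / S powr p) - u y * F u y / S)"
    unfolding deficit_def W1 W2 r by auto
  note iF = power_integral_le_integrable[OF nF power_integral_F_le[OF u]]
  have uF: "(\<integral>\<^sup>+y. ennreal (u y * F u y) \<partial>lborel) = power_integral q (conv H u)"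
  proof -
    have "conv H u x * conv H u x powr (q - 1) = conv H u x powr q" for x
      using conv_nonneg[OF kernel_H admissibleD(1)[OF u], of x] by (cases "conv H u x = 0") (auto simp: powr_diff)
    moreover have "(\<integral>\<^sup>+y. ennreal (u y * F u y) \<partial>lborel) = (\<integral>\<^sup>+x. ennreal (conv H u x * conv H u x powr (q - 1)) \<partial>lborel)"
      unfolding F_def H'_def by (rule conv_dual[OF kernel_H admissibleD(1)[OF u] g_nonneg_bounded(2)[OF u], symmetric])
    ultimately show ?thesis by (simp add: power_integral_def)
  qed
  have iuF: "integrable lborel (\<lambda>y. u y * F u y)"
    using uF S_upper[OF u] nonneg_bounded_nonneg[OF nF] nonneg_bounded_nonneg[OF admissibleD(1)[OF u]]
    by (intro integrableI_nonneg) (auto intro: order.strict_trans1)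
  have uFs: "s \<le> (\<integral>y. u y * F u y \<partial>lborel)"
  proof -
    have "ennreal s \<le> ennreal (\<integral>y. u y * F u y \<partial>lborel)"
      using nn_integral_eq_integral[OF iuF] nonneg_bounded_nonneg[OF nF] nonneg_bounded_nonneg[OF admissibleD(1)[OF u]] uF s by simp
    then show ?thesis using s nonneg_bounded_nonneg[OF nF] nonneg_bounded_nonneg[OF admissibleD(1)[OF u]]
      by (subst (asm) ennreal_le_iff) (auto intro!: integral_nonneg_AE)
  qed
  show "integrable lborel (deficit u)" unfolding d using admissibleD(3)[OF u] iF(1) iuF by auto
  have "(\<integral>y. deficit u y \<partial>lborel) = (\<integral>y. u y powr r \<partial>lborel) / r
      + (1 / p) * ((\<integral>y. F u y powr p \<partial>lborel) / S powr p) - (\<integral>y. u y * F u y \<partial>lborel) / S"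
    unfolding d using admissibleD(3)[OF u] iF(1) iuF by simp
  also have "\<dots> \<le> 1 / r + (1 / p) * 1 - s / S"
    using admissibleD(4)[OF u] iF(2) uFs S_pos p r(1)
    by (intro diff_mono add_mono mult_left_mono divide_right_mono) (auto simp: divide_le_eq_1)
  also have "\<dots> = 1 - s / S" using r(6) by simp
  finally show "(\<integral>y. deficit u y \<partial>lborel) \<le> 1 - s / S" .
qed

text \<open>A near maximizer \<open>u\<close> need not be close to \<open>W u\<close> pointwise, but \<open>H * u\<close> and \<open>H * W u\<close> are close,
  uniformly on the line and with a tolerance independent of \<open>u\<close>.\<close>

lemma almost_Euler_Lagrange:
  assumes e: "0 < e"
  shows "\<exists>t>0. \<forall>u\<in>admissible. \<forall>s. 0 \<le> s \<longrightarrow> ennreal s \<le> power_integral q (conv H u) \<longrightarrow> 1 - s / S < t \<longrightarrow>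
           (\<forall>x. \<bar>conv H u x - conv H (W u) x\<bar> \<le> e)"
proof -
  define d where "d = e / (2 * mass H)"
  have d: "0 < d" using e mass_pos by (simp add: d_def)
  obtain c where c: "0 \<le> c"
    "\<And>u w. 0 \<le> u \<Longrightarrow> 0 \<le> w \<Longrightarrow> w \<le> (mass H * G0 powr (q - 1) / S) powr (p - 1) \<Longrightarrow>
      \<bar>u - w\<bar> \<le> d + c * (u powr r / r + (1 - 1 / r) * w powr r - u * w powr (r - 1))"
    using young_deficit[OF r(1) d] by blast
  define t where "t = e / (2 * (c * C + 1))"
  have t: "0 < t" using e c(1) C(1) by (simp add: t_def add_nonneg_pos)
  have "\<bar>conv H u x - conv H (W u) x\<bar> \<le> e"
    if u: "u \<in> admissible" and s: "0 \<le> s" "ennreal s \<le> power_integral q (conv H u)" "1 - s / S < t" for u s x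
  proof -
    note D = deficit_integral[OF u s(1,2)]
    note [measurable] = conv_kernelD(3)[OF kernel_H]
    have D0: "0 \<le> deficit u y" for y
      unfolding deficit_def
      using young_powr[OF r(1) nonneg_bounded_nonneg[OF admissibleD(1)[OF u]] nonneg_bounded_nonneg[OF W_nonneg_bounded[OF u]]] by auto
    have le: "\<bar>u y - W u y\<bar> \<le> d + c * deficit u y" for y
      unfolding deficit_def
      using c(2)[OF nonneg_bounded_nonneg[OF admissibleD(1)[OF u]] nonneg_bounded_nonneg[OF W_nonneg_bounded[OF u]] W_bound[OF u]] .
    have int: "integrable lborel (\<lambda>y. H (x - y) * (u y - W u y))"
      using conv_integrable[OF kernel_H admissibleD(1)[OF u]] conv_integrable[OF kernel_H W_nonneg_bounded[OF u]]
      by (auto simp: right_diff_distrib)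
    have "conv H u x - conv H (W u) x = (\<integral>y. H (x - y) * (u y - W u y) \<partial>lborel)"
      unfolding conv_def right_diff_distrib
      by (intro Bochner_Integration.integral_diff[symmetric] conv_integrable kernel_H admissibleD(1)[OF u] W_nonneg_bounded[OF u])
    also have "\<bar>\<dots>\<bar> \<le> (\<integral>y. \<bar>H (x - y) * (u y - W u y)\<bar> \<partial>lborel)" by (rule integral_abs_bound)
    also have "\<dots> \<le> (\<integral>y. d * H (x - y) + c * C * deficit u y \<partial>lborel)"
    proof (rule integral_mono)
      show "integrable lborel (\<lambda>y. \<bar>H (x - y) * (u y - W u y)\<bar>)" using int by simp
      show "integrable lborel (\<lambda>y. d * H (x - y) + c * C * deficit u y)"
        using conv_kernel_shift(1)[OF kernel_H] D(1) by auto
      fix y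
      have "\<bar>H (x - y) * (u y - W u y)\<bar> \<le> H (x - y) * (d + c * deficit u y)"
        using le conv_kernelD(4)[OF kernel_H] by (auto simp: abs_mult intro: mult_left_mono)
      also have "\<dots> = d * H (x - y) + H (x - y) * (c * deficit u y)" by (simp add: algebra_simps)
      also have "\<dots> \<le> d * H (x - y) + C * (c * deficit u y)"
        using C(2) c(1) D0 by (intro add_left_mono mult_right_mono) auto
      finally show "\<bar>H (x - y) * (u y - W u y)\<bar> \<le> d * H (x - y) + c * C * deficit u y"
        by (simp add: ac_simps)
    qed
    also have "\<dots> = d * mass H + c * C * (\<integral>y. deficit u y \<partial>lborel)"
      using conv_kernel_shift(1,2)[OF kernel_H] D(1) by simp
    also have "\<dots> \<le> d * mass H + c * C * t"
      using D(2) s(3) c(1) C(1) by (intro add_left_mono mult_left_mono) auto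
    also have "\<dots> \<le> e / 2 + e / 2"
    proof (rule add_mono)
      show "d * mass H \<le> e / 2" using mass_pos by (simp add: d_def)
      have "0 < c * C + 1" using c(1) C(1) by (simp add: add_nonneg_pos)
      then show "c * C * t \<le> e / 2" using e unfolding t_def by (simp add: field_simps)
    qed
    finally show ?thesis by simp
  qed
  then show ?thesis using t by blast
qed

text \<open>Near maximizers can be translated so that \<open>H * u\<close> is bounded below at the origin by a constant
  independent of \<open>s\<close>.\<close>

lemma maximizing_element:
  assumes s: "S / 2 \<le> s" "s < S"
  shows "\<exists>u\<in>admissible. ennreal s \<le> power_integral q (conv H u) \<and> (S / (2 * mass H powr r)) powr (1 / (q - r)) \<le> conv H u 0"
proof -
  define c where "c = (S / (2 * mass H powr r)) powr (1 / (q - r))"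
  have "ennreal s < (SUP u\<in>admissible. power_integral q (conv H u))"
    unfolding sup_eq using s S_pos by (simp add: ennreal_less_iff)
  then obtain u where u: "u \<in> admissible" "ennreal s < power_integral q (conv H u)" by (auto simp: less_SUP_iff)
  have "\<exists>x. c < conv H u x"
  proof (rule ccontr)
    assume "\<nexists>x. c < conv H u x"
    then have "power_integral q (conv H u) \<le> ennreal (c powr (q - r) * mass H powr r)"
      by (intro power_integral_admissible_le[OF u(1)]) (auto simp: not_less)
    also have "c powr (q - r) * mass H powr r = S / 2"
      unfolding c_def powr_powr using r(2) mass_pos S_pos by simp
    also have "ennreal (S / 2) \<le> ennreal s" using s by (simp add: ennreal_leI)
    finally show False using u(2) by simp
  qed
  then obtain x where x: "c < conv H u x" by blast
  \<comment> \<open>translate the large value of \<open>H * u\<close> to the origin\<close>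
  define v where "v = (\<lambda>y. u (x + y))"
  have "nonneg_bounded v" using nonneg_bounded_affine[OF admissibleD(1)[OF u(1)], of x 1] by (simp add: v_def)
  moreover have "power_integral r v = power_integral r u" unfolding v_def by (rule power_integral_shift[OF admissibleD(1)[OF u(1)]])
  ultimately have "v \<in> admissible" using admissibleD(2)[OF u(1)] by (simp add: admissible_def)
  moreover have cv: "conv H v = (\<lambda>y. conv H u (x + y))" unfolding v_def by (rule ext) (rule conv_shift)
  moreover have "power_integral q (conv H v) = power_integral q (conv H u)"
    unfolding cv by (rule power_integral_shift[OF g_nonneg_bounded(1)[OF u(1)]])
  ultimately show ?thesis using u x by (intro bexI[of _ v]) (auto simp: c_def)
qed

text \<open>The limit of a centred maximizing sequence. It satisfies the system up to the constant \<open>S\<close>.\<close>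

lemma extremal:
  obtains f g where "nonneg_bounded f" "nonneg_bounded g" "power_integral p f < top" "power_integral q g < top" "0 < g 0"
    "f = conv H' (\<lambda>y. g y powr (q - 1))" "g = conv H (\<lambda>y. (f y / S) powr (p - 1))"
proof -
  define s where "s = (\<lambda>n::nat. S * (1 - 1 / (real n + 2)))"
  define c where "c = (S / (2 * mass H powr r)) powr (1 / (q - r))"
  have c: "0 < c" unfolding c_def using S_pos mass_pos by simp
  have s: "S / 2 \<le> s n" "s n < S" for n using S_pos by (auto simp: s_def field_simps)
  obtain u where u: "\<And>n. u n \<in> admissible" "\<And>n. ennreal (s n) \<le> power_integral q (conv H (u n))" "\<And>n. c \<le> conv H (u n) 0"
    using maximizing_element[OF s] unfolding c_def by metis
  have bd: "\<bar>conv H (u n) x\<bar> \<le> G0" for n x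
    using admissible_bound[OF u(1)] conv_nonneg[OF kernel_H admissibleD(1)[OF u(1)]] by simp
  obtain k g where k: "strict_mono (k :: nat \<Rightarrow> nat)" and g: "\<And>x. (\<lambda>n. conv H (u (k n)) x) \<longlonglongrightarrow> g x"
    using equicontinuous_subsequence[of "\<lambda>n. conv H (u n)", OF bd] admissible_equicontinuous u(1) by metis
  note gn = nonneg_bounded_limit[OF g_nonneg_bounded(1)[OF u(1)] admissible_bound[OF u(1)] g]
  define f where "f = conv H' (\<lambda>y. g y powr (q - 1))"
  define w where "w = (\<lambda>y. (f y / S) powr (p - 1))"
  have gq: "nonneg_bounded (\<lambda>y. g y powr (q - 1))" using nonneg_bounded_powr[OF gn(1)] q by simp
  have fl: "(\<lambda>n. F (u (k n)) x) \<longlonglongrightarrow> f x" for x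
    unfolding F_def f_def
  proof (rule conv_tendsto[OF kernel_H'(1) g_nonneg_bounded(2)[OF u(1)] _ _ gq])
    show "conv H (u (k n)) x powr (q - 1) \<le> G0 powr (q - 1)" for n x
      using q admissible_bound[OF u(1)] conv_nonneg[OF kernel_H admissibleD(1)[OF u(1)]] by (intro powr_mono2) auto
    show "(\<lambda>n. conv H (u (k n)) x powr (q - 1)) \<longlonglongrightarrow> g x powr (q - 1)" for x
      using g[of x] q conv_nonneg[OF kernel_H admissibleD(1)[OF u(1)]] by (intro tendsto_powr2) auto
  qed
  note fn = nonneg_bounded_limit[OF F_nonneg_bounded[OF u(1)] F_bound[OF u(1)] fl]
  have wl: "(\<lambda>n. W (u (k n)) x) \<longlonglongrightarrow> w x" for x
    unfolding W_def w_def using fl[of x] p S_pos nonneg_bounded_nonneg[OF F_nonneg_bounded[OF u(1)]]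
    by (intro tendsto_powr2 tendsto_intros) auto
  note wn = nonneg_bounded_limit[OF W_nonneg_bounded[OF u(1)] W_bound[OF u(1)] wl]
  have cl: "(\<lambda>n. conv H (W (u (k n))) x) \<longlonglongrightarrow> conv H w x" for x
    by (rule conv_tendsto[OF kernel_H W_nonneg_bounded[OF u(1)] W_bound[OF u(1)] wl wn(1)])
  have dl: "(\<lambda>n. conv H (u (k n)) x - conv H (W (u (k n))) x) \<longlonglongrightarrow> 0" for x
  proof (rule LIMSEQ_I)
    fix e :: real assume e: "0 < e"
    obtain t where t: "0 < t" "\<And>u s x. u \<in> admissible \<Longrightarrow> 0 \<le> s \<Longrightarrow> ennreal s \<le> power_integral q (conv H u) \<Longrightarrow> 1 - s / S < t \<Longrightarrow>
           \<bar>conv H u x - conv H (W u) x\<bar> \<le> e / 2"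
      using almost_Euler_Lagrange[of "e / 2"] e by auto
    obtain N where N: "1 / t < real N" using reals_Archimedean2 by blast
    have "\<bar>conv H (u (k n)) x - conv H (W (u (k n))) x\<bar> \<le> e / 2" if "N \<le> n" for n
    proof (rule t(2)[OF u(1) _ u(2)])
      show "0 \<le> s (k n)" using s(1)[of "k n"] S_pos by linarith
      have "1 - s (k n) / S = 1 / (real (k n) + 2)" using S_pos by (simp add: s_def)
      also have "\<dots> < t"
      proof -
        have "1 / t < real (k n) + 2"
          using N that seq_suble[OF k, of n] by linarith
        then show ?thesis using t(1) by (simp add: field_simps)
      qed
      finally show "1 - s (k n) / S < t" .
    qed
    then show "\<exists>N. \<forall>n\<ge>N. norm (conv H (u (k n)) x - conv H (W (u (k n))) x - 0) < e"
      using e by (intro exI[of _ N]) force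
  qed
  have gw: "g = conv H w"
  proof
    fix x
    have "(\<lambda>n. conv H (u (k n)) x - conv H (W (u (k n))) x) \<longlonglongrightarrow> g x - conv H w x"
      by (intro tendsto_diff g cl)
    then show "g x = conv H w x" using LIMSEQ_unique[OF _ dl[of x]] by fastforce
  qed
  show ?thesis
  proof (rule that[of f g])
    show "nonneg_bounded f" by (rule fn(1))
    show "nonneg_bounded g" by (rule gn(1))
    have "power_integral p f \<le> ennreal (S powr p)"
      by (rule power_integral_limit[OF F_nonneg_bounded[OF u(1)] fl _ power_integral_F_le[OF u(1)]]) (use p in auto)
    then show "power_integral p f < top" using ennreal_less_top order.strict_trans1 by blast
    have "power_integral q g \<le> ennreal S"
      by (rule power_integral_limit[OF g_nonneg_bounded(1)[OF u(1)] g _ S_upper[OF u(1)]]) (use q in auto)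
    then show "power_integral q g < top" using ennreal_less_top order.strict_trans1 by blast
    have "c \<le> g 0" using g[of 0] u(3) by (intro LIMSEQ_le_const) auto
    then show "0 < g 0" using c by simp
    show "f = conv H' (\<lambda>y. g y powr (q - 1))" by (rule f_def)
    show "g = conv H (\<lambda>y. (f y / S) powr (p - 1))" using gw unfolding w_def .
  qed
qed

lemma conv_cmult: "conv K (\<lambda>y. c * u y) x = c * conv K u x"
  unfolding conv_def by (simp add: mult.left_commute)

lemma power_integral_cmult_finite:
  assumes "nonneg_bounded u" "0 \<le> c" "power_integral s u < top" shows "power_integral s (\<lambda>x. c * u x) < top"
proof -
  note [measurable] = nonneg_bounded_meas[OF assms(1)]
  have "power_integral s (\<lambda>x. c * u x) = ennreal (c powr s) * power_integral s u"
    unfolding power_integral_def using assms(2) nonneg_bounded_nonneg[OF assms(1)]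
    by (simp add: powr_mult ennreal_mult nn_integral_cmult)
  then show ?thesis using assms(3) by (simp add: ennreal_mult_less_top)
qed

text \<open>The constant is removed by scaling \<open>f\<close> and \<open>g\<close>, which is possible because
  \<open>e = (p - 1) (q - 1)\<close> is not \<open>1\<close>. The factors \<open>a\<close> and \<open>b\<close> solve \<open>b = (a / S)\<^bsup>p-1\<^esup>\<close> and \<open>a = b\<^bsup>q-1\<^esup>\<close>.\<close>

theorem ground_state:
  obtains f g where "nonneg_bounded f" "nonneg_bounded g" "power_integral p f < top" "power_integral q g < top" "0 < g 0"
    "f = conv H' (\<lambda>y. g y powr (q - 1))" "g = conv H (\<lambda>y. f y powr (p - 1))"
proof -
  obtain f g where fg: "nonneg_bounded f" "nonneg_bounded g" "power_integral p f < top" "power_integral q g < top" "0 < g 0"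
    "f = conv H' (\<lambda>y. g y powr (q - 1))" "g = conv H (\<lambda>y. (f y / S) powr (p - 1))"
    by (rule extremal)
  define e where "e = (p - 1) * (q - 1)"
  have e: "1 < e" using p q pq by (simp add: e_def field_simps)
  define a where "a = S powr (e / (e - 1))"
  define b where "b = (a / S) powr (p - 1)"
  have a: "0 < a" and b: "0 < b" using S_pos by (auto simp: a_def b_def)
  have "a / S = S powr (e / (e - 1) - 1)" using S_pos by (simp add: a_def powr_diff)
  also have "e / (e - 1) - 1 = 1 / (e - 1)" using e by (simp add: field_simps)
  finally have aS: "a / S = S powr (1 / (e - 1))" .
  have "1 / (e - 1) * (p - 1) * (q - 1) = e / (e - 1)" by (simp add: e_def mult.assoc)
  then have ab: "b powr (q - 1) = a"
    unfolding b_def aS powr_powr by (simp only: a_def)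
  show ?thesis
  proof (rule that[of "\<lambda>x. (1 / a) * f x" "\<lambda>x. (1 / b) * g x"])
    show "nonneg_bounded (\<lambda>x. (1 / a) * f x)" "nonneg_bounded (\<lambda>x. (1 / b) * g x)"
      using nonneg_bounded_cmult[OF fg(1), of "1 / a"] nonneg_bounded_cmult[OF fg(2), of "1 / b"] a b by auto
    show "power_integral p (\<lambda>x. (1 / a) * f x) < top" "power_integral q (\<lambda>x. (1 / b) * g x) < top"
      using power_integral_cmult_finite[OF fg(1) _ fg(3), of "1 / a"] power_integral_cmult_finite[OF fg(2) _ fg(4), of "1 / b"] a b
      by auto
    show "0 < (1 / b) * g 0" using fg(5) b by simp
    show "(\<lambda>x. (1 / a) * f x) = conv H' (\<lambda>y. ((1 / b) * g y) powr (q - 1))"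
    proof
      fix x
      have "(\<lambda>y. ((1 / b) * g y) powr (q - 1)) = (\<lambda>y. (1 / a) * g y powr (q - 1))"
        using b nonneg_bounded_nonneg[OF fg(2)] ab by (simp add: powr_mult powr_divide)
      then show "(1 / a) * f x = conv H' (\<lambda>y. ((1 / b) * g y) powr (q - 1)) x"
        using fun_cong[OF fg(6), of x] by (simp only: conv_cmult)
    qed
    show "(\<lambda>x. (1 / b) * g x) = conv H (\<lambda>y. ((1 / a) * f y) powr (p - 1))"
    proof
      fix x
      have "(f y / S) powr (p - 1) = b * ((1 / a) * f y) powr (p - 1)" for y
        using a S_pos nonneg_bounded_nonneg[OF fg(1)] by (simp add: b_def powr_mult powr_divide)
      then have "g x = b * conv H (\<lambda>y. ((1 / a) * f y) powr (p - 1)) x"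
        using fun_cong[OF fg(7), of x] by (simp only: conv_cmult)
      then show "(1 / b) * g x = conv H (\<lambda>y. ((1 / a) * f y) powr (p - 1)) x" using b by simp
    qed
  qed
qed

end

section \<open>Solution of the differential system\<close>

theorem theorem2p1:
  fixes p q A \<Gamma> :: real
  assumes "1 < p" and "1 < q"
    and "A\<^sup>2 + \<Gamma> \<ge> 0" and "\<Gamma> \<noteq> 0"
    and "1 / p + 1 / q < 1"
  shows "\<exists>g f. g \<in> sobolev 2 (p / (p - 1)) \<and> f \<in> sobolev 2 (q / (q - 1)) \<and>
           solves_system p q A \<Gamma> g f \<and>
           \<not> (AE x in lebesgue. g x = 0 \<and> f x = 0)"
proof -
  define k where "k = sqrt (A\<^sup>2 + \<Gamma>)"
  define a where "a = A + k"
  define b where "b = A - k"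
  have sum: "a + b = 2 * A" by (simp add: a_def b_def)
  have "k\<^sup>2 = A\<^sup>2 + \<Gamma>" using assms(3) by (simp add: k_def)
  then have prod: "a * b = - \<Gamma>" by (simp add: a_def b_def power2_eq_square algebra_simps)
  then have ab: "a \<noteq> 0" "b \<noteq> 0" using assms(4) by auto
  define H where "H = conv (exp_kernel b) (exp_kernel a)"
  note Ea = exp_kernel_conv_kernel[OF ab(1)] and Eb = exp_kernel_conv_kernel[OF ab(2)]
  interpret cs: convolution_system H p q
  proof
    show "conv_kernel H" "0 < mass H" using conv_kernel_conv[OF Eb(1) Ea(1)] Ea(2) Eb(2) ab by (auto simp: H_def)
    show "\<exists>d>0. \<forall>h. \<bar>h\<bar> < d \<longrightarrow> (\<integral>x. \<bar>H (h + x) - H x\<bar> \<partial>lborel) \<le> e" if e: "0 < e" for e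
    proof (intro exI[of _ "e * \<bar>b\<bar> / 2"] conjI allI impI)
      show "0 < e * \<bar>b\<bar> / 2" using e ab by simp
      fix h assume h: "\<bar>h\<bar> < e * \<bar>b\<bar> / 2"
      have "(\<integral>x. \<bar>H (h + x) - H x\<bar> \<partial>lborel) \<le> mass (exp_kernel b) * (\<integral>x. \<bar>exp_kernel a (h + x) - exp_kernel a x\<bar> \<partial>lborel)"
        unfolding H_def by (rule conv_translation[OF Eb(1) Ea(1)])
      also have "\<dots> \<le> (1 / \<bar>b\<bar>) * (2 * \<bar>h\<bar>)"
        unfolding Eb(2) by (intro mult_left_mono exp_kernel_translation ab) auto
      also have "\<dots> \<le> e" using h ab by (simp add: field_simps)
      finally show "(\<integral>x. \<bar>H (h + x) - H x\<bar> \<partial>lborel) \<le> e" .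
    qed
  qed (use assms in auto)
  obtain f g where fg: "nonneg_bounded f" "nonneg_bounded g" "power_integral p f < top" "power_integral q g < top" "0 < g 0"
    "f = conv cs.H' (\<lambda>y. g y powr (q - 1))" "g = conv H (\<lambda>y. f y powr (p - 1))"
    by (rule cs.ground_state)
  have H': "cs.H' = conv (exp_kernel (- b)) (exp_kernel (- a))"
  proof
    show "cs.H' x = conv (exp_kernel (- b)) (exp_kernel (- a)) x" for x
      unfolding cs.H'_def unfolding H_def exp_kernel_reflect[symmetric] conv_reflect ..
  qed
  \<comment> \<open>\<open>\<sigma>\<close> is the sign of \<open>\<Gamma>\<close>; both equations hold for \<open>\<sigma> g\<close> and \<open>f\<close> since \<open>\<sigma>\<^sup>2 = 1\<close>\<close>
  define \<sigma> where "\<sigma> = - (sgn a * sgn b)"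
  have \<sigma>: "\<sigma> * (sgn a * sgn b) = - 1" "\<bar>\<sigma>\<bar> = 1"
    using ab by (auto simp: \<sigma>_def sgn_if)
  have nf: "nonneg_bounded (\<lambda>y. f y powr (p - 1))" and ng: "nonneg_bounded (\<lambda>y. g y powr (q - 1))"
    using nonneg_bounded_powr fg(1,2) assms(1,2) by auto
  have pf: "power_integral (p / (p - 1)) (\<lambda>y. f y powr (p - 1)) < top"
    and pg: "power_integral (q / (q - 1)) (\<lambda>y. g y powr (q - 1)) < top"
    using fg(3,4) assms(1,2) by (auto simp: power_integral_def powr_powr)
  have p': "1 < p / (p - 1)" and q': "1 < q / (q - 1)" using assms(1,2) by auto
  have gs: "\<sigma> * g x = \<sigma> * conv (conv (exp_kernel b) (exp_kernel a)) (\<lambda>y. f y powr (p - 1)) x" for x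
    using fun_cong[OF fg(7), of x] by (simp add: H_def)
  have fs: "f x = 1 * conv (conv (exp_kernel (- b)) (exp_kernel (- a))) (\<lambda>y. g y powr (q - 1)) x" for x
    using fun_cong[OF fg(6), of x] by (simp add: H')
  note solg = second_order_solution[OF ab nf p' pf gs]
  note solf = second_order_solution[OF _ _ ng q' pg fs]
  obtain g1 g2 where g12: "weak_deriv 1 (\<lambda>x. \<sigma> * g x) g1" "weak_deriv 2 (\<lambda>x. \<sigma> * g x) g2"
    "\<And>x. g2 x - (a + b) * g1 x + a * b * (\<sigma> * g x) = \<sigma> * (sgn a * sgn b) * f x powr (p - 1)"
    using solg(2) by blast
  obtain f1 f2 where f12: "weak_deriv 1 f f1" "weak_deriv 2 f f2"
    "\<And>x. f2 x - (- a + - b) * f1 x + - a * - b * f x = 1 * (sgn (- a) * sgn (- b)) * g x powr (q - 1)"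
    using solf(2) ab by auto
  have pw: "\<bar>t\<bar> powr (s - 2) * t = t powr (s - 1)" if "0 \<le> t" for s t :: real
    using that by (cases "t = 0") (auto simp: powr_diff power2_eq_square)
  have eq1: "- g2 x + 2 * A * g1 x + \<Gamma> * (\<sigma> * g x) = \<bar>f x\<bar> powr (p - 2) * f x" for x
    using g12(3)[of x] pw[OF nonneg_bounded_nonneg[OF fg(1), of x]] unfolding sum prod \<sigma>(1) by simp
  have eq2: "- f2 x - 2 * A * f1 x + \<Gamma> * f x = \<bar>\<sigma> * g x\<bar> powr (q - 2) * (\<sigma> * g x)" for x
  proof -
    have s': "- a + - b = - (2 * A)" "- a * - b = - \<Gamma>" "1 * (sgn (- a) * sgn (- b)) = - \<sigma>"
      using sum prod by (auto simp: \<sigma>_def sgn_minus)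
    have "\<bar>\<sigma> * g x\<bar> powr (q - 2) * (\<sigma> * g x) = \<sigma> * g x powr (q - 1)"
      using pw[OF nonneg_bounded_nonneg[OF fg(2), of x], of q] unfolding abs_mult \<sigma>(2) by (simp add: mult.left_commute)
    then show ?thesis using f12(3)[of x] unfolding s' by linarith
  qed
  have "solves_system p q A \<Gamma> (\<lambda>x. \<sigma> * g x) f"
    unfolding solves_system_def using g12(1,2) f12(1,2) eq1 eq2 by blast
  moreover have "\<not> (AE x in lebesgue. \<sigma> * g x = 0 \<and> f x = 0)"
  proof
    assume "AE x in lebesgue. \<sigma> * g x = 0 \<and> f x = 0"
    then have "AE x in lborel. f x = 0" unfolding AE_completion_iff by (rule eventually_mono) simp
    then have "AE y in lborel. H (0 - y) * f y powr (p - 1) = 0" by (rule eventually_mono) simp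
    then have "g 0 = 0" unfolding fun_cong[OF fg(7), of 0] conv_def by (rule integral_eq_zero_AE)
    then show False using fg(5) by simp
  qed
  moreover have "f \<in> sobolev 2 (q / (q - 1))" using solf(1) ab by simp
  ultimately show ?thesis using solg(1) by blast
qed

end
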